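(* Let $(\mathfrak g,\delta)$ be a Lie bialgebra and let $\{r^{(c)}\}_{c\in C}\subset\mathfrak g\otimes\mathfrak g$ be a family of classical r-matrices for $(\mathfrak g,\delta)$. Then in $U(\mathfrak g)^{\otimes3}$ $$[r_{i,j}^{(c)},r_{i,k}^{(c')}]+[r_{i,j}^{(c)},r_{j,k}^{(c'')}]+[r_{i,k}^{(c')},r_{j,k}^{(c'')}]=0$$ for all $c,c',c''\in C$ with $c'\in\{c,c''\}$ and all $i,j,k$ with $\{i,j,k\}=\{1,2,3\}$.
   Context: The base field has characteristic zero. $\Delta$ is the standard comultiplication of $U(\mathfrak g)$, $\mathfrak g\otimes\mathfrak g\subset U(\mathfrak g)\otimes U(\mathfrak g)$, and $\tau_{i,j}$ swaps tensor factors $i$ and $j$. For $x=\sum_t a_t\otimes b_t\in\mathfrak g\otimes\mathfrak g$ and distinct $i,j\in\{1,2,3\}$, $x_{i,j}\in U(\mathfrak g)^{\otimes3}$ has $a_t$ in position $i$, $b_t$ in position $j$ and $1$ in the remaining position (summed over $t$). A Lie cobracket on $\mathfrak g$ is a linear map $\delta:\mathfrak g\to\mathfrak g\otimes\mathfrak g$ with $\delta([x,y])=[\delta(x),\Delta(y)]-[\delta(y),\Delta(x)]$, $\tau_{1,2}\circ\delta=-\delta$ and $(\mathrm{id}+\tau_{1,2}\tau_{2,3}+\tau_{2,3}\tau_{1,2})\circ(\delta\otimes\mathrm{id})\circ\delta=0$; $(\mathfrak g,\delta)$ is then a Lie bialgebra. A classical r-matrix for $(\mathfrak g,\delta)$ is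 $r\in\mathfrak g\otimes\mathfrak g$ with $\delta(x)=[r,\Delta(x)]$ for all $x\in\mathfrak g$ and $[r_{1,2},r_{1,3}]+[r_{1,2},r_{2,3}]+[r_{1,3},r_{2,3}]=0$. *)

theory Defs
  imports
    "HOL-Algebra.Free_Abelian_Groups"
    "HOL-Algebra.QuotRing"
    "HOL-Algebra.Module"
    "HOL-Algebra.Algebraic_Closure_Type"
    "HOL-Library.Poly_Mapping"
begin

section \<open>Tensor products over a field\<close>

text \<open>
  Vector spaces and associative algebras over the field \<open>'k\<close> are \<open>('k, 'a) module\<close> records.
  For a mere vector space the fields \<open>mult\<close> and \<open>one\<close> carry no information.
  The tensor product is the free abelian group on pairs modulo biadditivity and
  \<open>'k\<close>-balancedness.
\<close>

definition tensor_relations :: "('k, 'a) module \<Rightarrow> ('k, 'b) module \<Rightarrow> ('a \<times> 'b \<Rightarrow>\<^sub>0 int) set" where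
  "tensor_relations A B =
     {frag_of (a \<oplus>\<^bsub>A\<^esub> a', b) - frag_of (a, b) - frag_of (a', b) | a a' b.
        a \<in> carrier A \<and> a' \<in> carrier A \<and> b \<in> carrier B} \<union>
     {frag_of (a, b \<oplus>\<^bsub>B\<^esub> b') - frag_of (a, b) - frag_of (a, b') | a b b'.
        a \<in> carrier A \<and> b \<in> carrier B \<and> b' \<in> carrier B} \<union>
     {frag_of (c \<odot>\<^bsub>A\<^esub> a, b) - frag_of (a, c \<odot>\<^bsub>B\<^esub> b) | c a b.
        a \<in> carrier A \<and> b \<in> carrier B}"

definition tensor_kernel :: "('k, 'a) module \<Rightarrow> ('k, 'b) module \<Rightarrow> ('a \<times> 'b \<Rightarrow>\<^sub>0 int) set" where
  "tensor_kernel A B =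
     generate (free_Abelian_group (carrier A \<times> carrier B)) (tensor_relations A B)"

definition tensor_group :: "('k, 'a) module \<Rightarrow> ('k, 'b) module \<Rightarrow> ('a \<times> 'b \<Rightarrow>\<^sub>0 int) set monoid" where
  "tensor_group A B = free_Abelian_group (carrier A \<times> carrier B) Mod tensor_kernel A B"

definition pure_tensor ::
  "('k, 'a) module \<Rightarrow> ('k, 'b) module \<Rightarrow> 'a \<Rightarrow> 'b \<Rightarrow> ('a \<times> 'b \<Rightarrow>\<^sub>0 int) set" where
  "pure_tensor A B a b =
     tensor_kernel A B #>\<^bsub>free_Abelian_group (carrier A \<times> carrier B)\<^esub> frag_of (a, b)"

text \<open>
  The additive map on the tensor product with prescribed values on pure tensors. It exists when
  the prescription is biadditive and balanced (see \<open>tensor_lift\<close> below), and is then unique on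
  the carrier; its values outside the carrier are irrelevant.
\<close>

definition tensor_lift ::
  "('k, 'a) module \<Rightarrow> ('k, 'b) module \<Rightarrow> ('c, 'm) ring_scheme \<Rightarrow> ('a \<Rightarrow> 'b \<Rightarrow> 'c) \<Rightarrow>
   ('a \<times> 'b \<Rightarrow>\<^sub>0 int) set \<Rightarrow> 'c" where
  "tensor_lift A B C f =
     (SOME h. h \<in> hom (tensor_group A B) (add_monoid C) \<and>
        (\<forall>a\<in>carrier A. \<forall>b\<in>carrier B. h (pure_tensor A B a b) = f a b))"

text \<open>
  Only the additive structure of \<open>tensor_add_ring\<close> is meaningful: it serves as the target of the
  lifts that define the scalar action and the product
  \<open>(a \<otimes> b) (a' \<otimes> b') = a a' \<otimes> b b'\<close> on the tensor product.
\<close>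

definition tensor_add_ring ::
  "('k, 'a) module \<Rightarrow> ('k, 'b) module \<Rightarrow> ('a \<times> 'b \<Rightarrow>\<^sub>0 int) set ring" where
  "tensor_add_ring A B =
     \<lparr>carrier = carrier (tensor_group A B), monoid.mult = undefined, monoid.one = undefined,
      ring.zero = \<one>\<^bsub>tensor_group A B\<^esub>, ring.add = monoid.mult (tensor_group A B)\<rparr>"

definition tensor ::
  "('k, 'a) module \<Rightarrow> ('k, 'b) module \<Rightarrow> ('k, ('a \<times> 'b \<Rightarrow>\<^sub>0 int) set) module" where
  "tensor A B =
     (let T = tensor_add_ring A B in
      \<lparr>carrier = carrier T,
       monoid.mult = (\<lambda>s t. tensor_lift A B T
         (\<lambda>a b. tensor_lift A B T
           (\<lambda>a' b'. pure_tensor A B (a \<otimes>\<^bsub>A\<^esub> a') (b \<otimes>\<^bsub>B\<^esub> b')) t) s),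
       monoid.one = pure_tensor A B \<one>\<^bsub>A\<^esub> \<one>\<^bsub>B\<^esub>,
       ring.zero = ring.zero T,
       ring.add = ring.add T,
       module.smult = (\<lambda>c. tensor_lift A B T (\<lambda>a b. pure_tensor A B (c \<odot>\<^bsub>A\<^esub> a) b))\<rparr>)"

lemma tensor_kernel_normal:
  fixes A :: "('k, 'a) module" and B :: "('k, 'b) module"
  assumes "abelian_group A" "\<And>c a. a \<in> carrier A \<Longrightarrow> c \<odot>\<^bsub>A\<^esub> a \<in> carrier A"
    and "abelian_group B" "\<And>c b. b \<in> carrier B \<Longrightarrow> c \<odot>\<^bsub>B\<^esub> b \<in> carrier B"
  shows "tensor_relations A B \<subseteq> carrier (free_Abelian_group (carrier A \<times> carrier B))"
    and "tensor_kernel A B \<lhd> free_Abelian_group (carrier A \<times> carrier B)"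
proof -
  interpret A: abelian_group A by fact
  interpret B: abelian_group B by fact
  let ?F = "free_Abelian_group (carrier A \<times> carrier B)"
  interpret F: comm_group ?F by (rule abelian_free_Abelian_group)
  have diff: "x - y \<in> carrier ?F" if "x \<in> carrier ?F" "y \<in> carrier ?F" for x y
    using that keys_diff[of x y] by auto
  show *: "tensor_relations A B \<subseteq> carrier ?F"
    using assms(2,4) unfolding tensor_relations_def
    by (auto simp del: carrier_free_Abelian_group_iff intro!: diff)
  then have "subgroup (tensor_kernel A B) ?F"
    unfolding tensor_kernel_def by (rule F.generate_is_subgroup)
  then show "tensor_kernel A B \<lhd> ?F"
    by (simp add: F.normal_iff_subgroup)
qed

lemma tensor_lift:
  fixes A :: "('k, 'a) module" and B :: "('k, 'b) module"
  assumes A: "abelian_group A" "\<And>c a. a \<in> carrier A \<Longrightarrow> c \<odot>\<^bsub>A\<^esub> a \<in> carrier A"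
    and B: "abelian_group B" "\<And>c b. b \<in> carrier B \<Longrightarrow> c \<odot>\<^bsub>B\<^esub> b \<in> carrier B"
    and C: "abelian_group C"
    and closed: "\<And>a b. a \<in> carrier A \<Longrightarrow> b \<in> carrier B \<Longrightarrow> f a b \<in> carrier C"
    and addl: "\<And>a a' b. a \<in> carrier A \<Longrightarrow> a' \<in> carrier A \<Longrightarrow> b \<in> carrier B \<Longrightarrow>
           f (a \<oplus>\<^bsub>A\<^esub> a') b = f a b \<oplus>\<^bsub>C\<^esub> f a' b"
    and addr: "\<And>a b b'. a \<in> carrier A \<Longrightarrow> b \<in> carrier B \<Longrightarrow> b' \<in> carrier B \<Longrightarrow>
           f a (b \<oplus>\<^bsub>B\<^esub> b') = f a b \<oplus>\<^bsub>C\<^esub> f a b'"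
    and balanced: "\<And>c a b. a \<in> carrier A \<Longrightarrow> b \<in> carrier B \<Longrightarrow> f (c \<odot>\<^bsub>A\<^esub> a) b = f a (c \<odot>\<^bsub>B\<^esub> b)"
  shows "tensor_lift A B C f \<in> hom (tensor_group A B) (add_monoid C)"
    and "\<And>a b. a \<in> carrier A \<Longrightarrow> b \<in> carrier B \<Longrightarrow>
           tensor_lift A B C f (pure_tensor A B a b) = f a b"
proof -
  interpret A: abelian_group A by fact
  interpret B: abelian_group B by fact
  interpret C: abelian_group C by fact
  let ?S = "carrier A \<times> carrier B"
  let ?F = "free_Abelian_group ?S"
  interpret F: comm_group ?F by (rule abelian_free_Abelian_group)
  obtain h0 where h0: "h0 \<in> hom ?F (add_monoid C)"
    and h0_of: "\<And>x. x \<in> ?S \<Longrightarrow> h0 (frag_of x) = (\<lambda>(a, b). f a b) x"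
  proof (rule C.a_comm_group[THEN comm_group.free_Abelian_group_universal])
    show "(\<lambda>(a, b). f a b) ` ?S \<subseteq> carrier (add_monoid C)" using closed by auto
  qed blast
  interpret h: group_hom ?F "add_monoid C" h0
    by unfold_locales (rule h0)
  have h0_diff: "h0 (x - y) = h0 x \<ominus>\<^bsub>C\<^esub> h0 y"
    if "x \<in> carrier ?F" "y \<in> carrier ?F" for x y
  proof -
    have "h0 (x - y) = h0 (x \<otimes>\<^bsub>?F\<^esub> inv\<^bsub>?F\<^esub> y)" using that by simp
    also have "\<dots> = h0 x \<oplus>\<^bsub>C\<^esub> h0 (inv\<^bsub>?F\<^esub> y)"
      using h.hom_mult[of x "inv\<^bsub>?F\<^esub> y"] that F.inv_closed[of y] by (simp del: inv_free_Abelian_group)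
    also have "h0 (inv\<^bsub>?F\<^esub> y) = \<ominus>\<^bsub>C\<^esub> h0 y"
      using h.hom_inv[of y] that by (simp add: a_inv_def)
    finally show ?thesis by (simp add: a_minus_def)
  qed
  have mem: "frag_of (a, b) \<in> carrier ?F" if "a \<in> carrier A" "b \<in> carrier B" for a b
    using that by simp
  have mem_diff: "x - y \<in> carrier ?F" if "x \<in> carrier ?F" "y \<in> carrier ?F" for x y
    using that keys_diff[of x y] by auto
  have val: "h0 (frag_of (a, b)) = f a b" if "a \<in> carrier A" "b \<in> carrier B" for a b
    using h0_of[of "(a, b)"] that by simp
  have cancel: "(u \<oplus>\<^bsub>C\<^esub> v) \<ominus>\<^bsub>C\<^esub> u \<ominus>\<^bsub>C\<^esub> v = \<zero>\<^bsub>C\<^esub>" if "u \<in> carrier C" "v \<in> carrier C" for u v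
  proof -
    have "(u \<oplus>\<^bsub>C\<^esub> v) \<ominus>\<^bsub>C\<^esub> u \<ominus>\<^bsub>C\<^esub> v = (v \<oplus>\<^bsub>C\<^esub> u) \<oplus>\<^bsub>C\<^esub> \<ominus>\<^bsub>C\<^esub> u \<oplus>\<^bsub>C\<^esub> \<ominus>\<^bsub>C\<^esub> v"
      using that by (simp add: a_minus_def C.a_comm)
    also have "\<dots> = \<zero>\<^bsub>C\<^esub>"
      using that by (simp add: C.a_assoc C.r_neg C.r_neg1)
    finally show ?thesis .
  qed
  have rel0: "h0 x = \<zero>\<^bsub>C\<^esub>" if "x \<in> tensor_relations A B" for x
    using that unfolding tensor_relations_def
  proof (elim UnE CollectE exE conjE)
    fix a a' b assume x: "x = frag_of (a \<oplus>\<^bsub>A\<^esub> a', b) - frag_of (a, b) - frag_of (a', b)"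
      and ab: "a \<in> carrier A" "a' \<in> carrier A" "b \<in> carrier B"
    have "a \<oplus>\<^bsub>A\<^esub> a' \<in> carrier A" using ab by simp
    then show ?thesis
      unfolding x using ab by (simp only: h0_diff mem mem_diff val addl cancel closed)
  next
    fix a b b' assume x: "x = frag_of (a, b \<oplus>\<^bsub>B\<^esub> b') - frag_of (a, b) - frag_of (a, b')"
      and ab: "a \<in> carrier A" "b \<in> carrier B" "b' \<in> carrier B"
    have "b \<oplus>\<^bsub>B\<^esub> b' \<in> carrier B" using ab by simp
    then show ?thesis
      unfolding x using ab by (simp only: h0_diff mem mem_diff val addr cancel closed)
  next
    fix c a b assume x: "x = frag_of (c \<odot>\<^bsub>A\<^esub> a, b) - frag_of (a, c \<odot>\<^bsub>B\<^esub> b)"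
      and ab: "a \<in> carrier A" "b \<in> carrier B"
    have "f a (c \<odot>\<^bsub>B\<^esub> b) \<in> carrier C" using ab B(2) closed by blast
    then show ?thesis
      unfolding x using ab A(2) B(2)
      by (simp only: h0_diff mem val balanced) (simp add: a_minus_def C.r_neg)
  qed
  have "tensor_kernel A B \<subseteq> kernel ?F (add_monoid C) h0"
    unfolding tensor_kernel_def
    using tensor_kernel_normal(1)[OF A B] rel0
    by (intro F.generate_subgroup_incl h.subgroup_kernel)
      (auto simp: kernel_def simp del: carrier_free_Abelian_group_iff)
  then obtain g where g: "g \<in> hom (tensor_group A B) (add_monoid C)"
    and g_of: "\<And>x. x \<in> carrier ?F \<Longrightarrow> g (tensor_kernel A B #>\<^bsub>?F\<^esub> x) = h0 x"
    unfolding tensor_group_def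
    using h.FactGroup_universal_kernel[OF tensor_kernel_normal(2)[OF A B]] by blast
  have "\<exists>h. h \<in> hom (tensor_group A B) (add_monoid C) \<and>
      (\<forall>a\<in>carrier A. \<forall>b\<in>carrier B. h (pure_tensor A B a b) = f a b)"
    using g g_of[OF mem] val by (intro exI[of _ g]) (auto simp: pure_tensor_def)
  from someI_ex[OF this]
  show "tensor_lift A B C f \<in> hom (tensor_group A B) (add_monoid C)"
    and "\<And>a b. a \<in> carrier A \<Longrightarrow> b \<in> carrier B \<Longrightarrow>
           tensor_lift A B C f (pure_tensor A B a b) = f a b"
    unfolding tensor_lift_def by blast+
qed


section \<open>Lie algebras and their enveloping algebras\<close>

locale lie_algebra = vector_space scale
  for scale :: "'k::field_char_0 \<Rightarrow> 'g::ab_group_add \<Rightarrow> 'g" +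
  fixes bracket :: "'g \<Rightarrow> 'g \<Rightarrow> 'g"
  assumes bracket_add_left: "bracket (x + y) z = bracket x z + bracket y z"
    and bracket_add_right: "bracket x (y + z) = bracket x y + bracket x z"
    and bracket_scale_left: "bracket (scale c x) y = scale c (bracket x y)"
    and bracket_scale_right: "bracket x (scale c y) = scale c (bracket x y)"
    and bracket_self: "bracket x x = 0"
    and jacobi: "bracket x (bracket y z) + bracket y (bracket z x) + bracket z (bracket x y) = 0"

definition space_module :: "('k \<Rightarrow> 'g::ab_group_add \<Rightarrow> 'g) \<Rightarrow> ('k, 'g) module" where
  "space_module scale =
     \<lparr>carrier = UNIV, monoid.mult = undefined, monoid.one = undefined, ring.zero = 0, ring.add = (+),
      module.smult = scale\<rparr>"

text \<open>
  Words form the free monoid, written additively because \<open>Poly_Mapping\<close> uses the addition of the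
  exponents for its convolution product. Hence \<open>'g word \<Rightarrow>\<^sub>0 'k\<close> is the free associative unital
  algebra on the set \<open>'g\<close>.
\<close>

datatype 'g word = Word "'g list"

instantiation word :: (type) monoid_add
begin

definition zero_word :: "'a word" where
  "zero_word = Word []"

fun plus_word :: "'a word \<Rightarrow> 'a word \<Rightarrow> 'a word" where
  "plus_word (Word u) (Word v) = Word (u @ v)"

instance
proof
  fix a b c :: "'a word"
  show "a + b + c = a + (b + c)"
    by (cases a; cases b; cases c) simp
  show "0 + a = a" "a + 0 = a"
    by (cases a; simp add: zero_word_def)+
qed

end

abbreviation letter :: "'g \<Rightarrow> ('g word \<Rightarrow>\<^sub>0 'k::field_char_0)" where
  "letter x \<equiv> Poly_Mapping.single (Word [x]) 1"

abbreviation scalar :: "'k \<Rightarrow> ('g word \<Rightarrow>\<^sub>0 'k::field_char_0)" where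
  "scalar c \<equiv> Poly_Mapping.single 0 c"

abbreviation free_alg :: "('g word \<Rightarrow>\<^sub>0 'k::field_char_0) ring" where
  "free_alg \<equiv> ring_of_type_algebra"

text \<open>
  The first two families of relations make the free algebra on the underlying set of the Lie
  algebra into the tensor algebra of the underlying vector space.
\<close>

definition uea_relations ::
  "('k::field_char_0 \<Rightarrow> 'g::ab_group_add \<Rightarrow> 'g) \<Rightarrow> ('g \<Rightarrow> 'g \<Rightarrow> 'g) \<Rightarrow> ('g word \<Rightarrow>\<^sub>0 'k) set" where
  "uea_relations scale bracket =
     {letter (x + y) - letter x - letter y | x y. True} \<union>
     {letter (scale c x) - scalar c * letter x | c x. True} \<union>
     {letter x * letter y - letter y * letter x - letter (bracket x y) | x y. True}"

definition uea_ideal ::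
  "('k::field_char_0 \<Rightarrow> 'g::ab_group_add \<Rightarrow> 'g) \<Rightarrow> ('g \<Rightarrow> 'g \<Rightarrow> 'g) \<Rightarrow> ('g word \<Rightarrow>\<^sub>0 'k) set" where
  "uea_ideal scale bracket = Idl\<^bsub>free_alg\<^esub> (uea_relations scale bracket)"

definition uea ::
  "('k::field_char_0 \<Rightarrow> 'g::ab_group_add \<Rightarrow> 'g) \<Rightarrow> ('g \<Rightarrow> 'g \<Rightarrow> 'g) \<Rightarrow>
   ('k, ('g word \<Rightarrow>\<^sub>0 'k) set) module" where
  "uea scale bracket =
     (let I = uea_ideal scale bracket; Q = free_alg Quot I in
      \<lparr>carrier = carrier Q, monoid.mult = monoid.mult Q, monoid.one = monoid.one Q,
       ring.zero = ring.zero Q, ring.add = ring.add Q,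
       module.smult = (\<lambda>c u. (I +>\<^bsub>free_alg\<^esub> scalar c) \<otimes>\<^bsub>Q\<^esub> u)\<rparr>)"

definition uea_incl ::
  "('k::field_char_0 \<Rightarrow> 'g::ab_group_add \<Rightarrow> 'g) \<Rightarrow> ('g \<Rightarrow> 'g \<Rightarrow> 'g) \<Rightarrow> 'g \<Rightarrow> ('g word \<Rightarrow>\<^sub>0 'k) set" where
  "uea_incl scale bracket x = uea_ideal scale bracket +>\<^bsub>free_alg\<^esub> letter x"

definition uea2 where
  "uea2 scale bracket = tensor (uea scale bracket) (uea scale bracket)"

definition uea3 where
  "uea3 scale bracket = tensor (uea2 scale bracket) (uea scale bracket)"

definition pure2 where
  "pure2 scale bracket u v = pure_tensor (uea scale bracket) (uea scale bracket) u v"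

definition pure3 where
  "pure3 scale bracket u v w =
     pure_tensor (uea2 scale bracket) (uea scale bracket) (pure2 scale bracket u v) w"

text \<open>
  The standard comultiplication is the unital algebra homomorphism for which the elements of the
  Lie algebra are primitive; these conditions determine it on the carrier of the enveloping
  algebra.
\<close>

definition comult where
  "comult scale bracket =
     (let U = uea scale bracket; i = uea_incl scale bracket in
      SOME h. h \<in> ring_hom U (uea2 scale bracket) \<and>
        (\<forall>c. \<forall>u\<in>carrier U. h (c \<odot>\<^bsub>U\<^esub> u) = c \<odot>\<^bsub>uea2 scale bracket\<^esub> h u) \<and>
        (\<forall>x. h (i x) =
           pure2 scale bracket (i x) \<one>\<^bsub>U\<^esub> \<oplus>\<^bsub>uea2 scale bracket\<^esub>
           pure2 scale bracket \<one>\<^bsub>U\<^esub> (i x)))"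

definition commutator :: "('a, 'm) ring_scheme \<Rightarrow> 'a \<Rightarrow> 'a \<Rightarrow> 'a" where
  "commutator R x y = x \<otimes>\<^bsub>R\<^esub> y \<ominus>\<^bsub>R\<^esub> y \<otimes>\<^bsub>R\<^esub> x"


section \<open>Tensors over the Lie algebra\<close>

definition lie2 where
  "lie2 scale = tensor (space_module scale) (space_module scale)"

definition lie3 where
  "lie3 scale = tensor (lie2 scale) (space_module scale)"

definition pure_lie2 where
  "pure_lie2 scale a b = pure_tensor (space_module scale) (space_module scale) a b"

definition pure_lie3 where
  "pure_lie3 scale t c = pure_tensor (lie2 scale) (space_module scale) t c"

definition flip where
  "flip scale = tensor_lift (space_module scale) (space_module scale) (lie2 scale)
     (\<lambda>a b. pure_lie2 scale b a)"

definition flip12 where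
  "flip12 scale = tensor_lift (lie2 scale) (space_module scale) (lie3 scale)
     (\<lambda>t c. pure_lie3 scale (flip scale t) c)"

definition flip23 where
  "flip23 scale = tensor_lift (lie2 scale) (space_module scale) (lie3 scale)
     (\<lambda>t c. tensor_lift (space_module scale) (space_module scale) (lie3 scale)
        (\<lambda>a b. pure_lie3 scale (pure_lie2 scale a c) b) t)"

definition cobracket_id where
  "cobracket_id scale cobr = tensor_lift (space_module scale) (space_module scale) (lie3 scale)
     (\<lambda>a b. pure_lie3 scale (cobr a) b)"

text \<open>
  The canonical map realising the tensor square of the Lie algebra inside that of its enveloping
  algebra (injective by Poincare-Birkhoff-Witt). Identities that live in the latter are stated
  there, after applying this map.
\<close>

definition embed2 where
  "embed2 scale bracket =
     tensor_lift (space_module scale) (space_module scale) (uea2 scale bracket)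
       (\<lambda>a b. pure2 scale bracket (uea_incl scale bracket a) (uea_incl scale bracket b))"

text \<open>
  \<open>place scale bracket i j x\<close> is the element \<open>x\<^sub>i\<^sub>,\<^sub>j\<close> of the tensor cube of the enveloping
  algebra; it is meant for distinct \<open>i\<close> and \<open>j\<close> among 1, 2, 3.
\<close>

definition place where
  "place scale bracket i j =
     tensor_lift (space_module scale) (space_module scale) (uea3 scale bracket)
       (\<lambda>a b. let p = (\<lambda>_::nat. \<one>\<^bsub>uea scale bracket\<^esub>)
                       (i := uea_incl scale bracket a, j := uea_incl scale bracket b)
              in pure3 scale bracket (p 1) (p 2) (p 3))"


section \<open>Lie bialgebras and classical r-matrices\<close>

locale lie_bialgebra = lie_algebra scale bracket
  for scale :: "'k::field_char_0 \<Rightarrow> 'g::ab_group_add \<Rightarrow> 'g" and bracket +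
  fixes cobracket :: "'g \<Rightarrow> ('g \<times> 'g \<Rightarrow>\<^sub>0 int) set"
  assumes cobracket_closed: "cobracket x \<in> carrier (lie2 scale)"
    and cobracket_add: "cobracket (x + y) = cobracket x \<oplus>\<^bsub>lie2 scale\<^esub> cobracket y"
    and cobracket_scale: "cobracket (scale c x) = c \<odot>\<^bsub>lie2 scale\<^esub> cobracket x"
    and cobracket_cocycle:
      "embed2 scale bracket (cobracket (bracket x y)) =
         commutator (uea2 scale bracket) (embed2 scale bracket (cobracket x))
           (comult scale bracket (uea_incl scale bracket y))
         \<ominus>\<^bsub>uea2 scale bracket\<^esub>
         commutator (uea2 scale bracket) (embed2 scale bracket (cobracket y))
           (comult scale bracket (uea_incl scale bracket x))"
    and cobracket_antisym: "flip scale (cobracket x) = \<ominus>\<^bsub>lie2 scale\<^esub> cobracket x"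
    and co_jacobi:
      "(let t = cobracket_id scale cobracket (cobracket x) in
        t \<oplus>\<^bsub>lie3 scale\<^esub> flip12 scale (flip23 scale t)
          \<oplus>\<^bsub>lie3 scale\<^esub> flip23 scale (flip12 scale t)) = \<zero>\<^bsub>lie3 scale\<^esub>"

definition classical_r_matrix where
  "classical_r_matrix scale bracket cobracket r \<longleftrightarrow>
     r \<in> carrier (lie2 scale) \<and>
     (\<forall>x. embed2 scale bracket (cobracket x) =
        commutator (uea2 scale bracket) (embed2 scale bracket r)
          (comult scale bracket (uea_incl scale bracket x))) \<and>
     (let U3 = uea3 scale bracket; P = (\<lambda>i j. place scale bracket i j r) in
      commutator U3 (P 1 2) (P 1 3) \<oplus>\<^bsub>U3\<^esub> commutator U3 (P 1 2) (P 2 3)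
        \<oplus>\<^bsub>U3\<^esub> commutator U3 (P 1 3) (P 2 3) = \<zero>\<^bsub>U3\<^esub>)"

end

theory Submission
  imports Defs
begin

text \<open>
  Two classical r-matrices of the same Lie bialgebra differ by an element \<open>s\<close> commuting with all
  \<open>\<Delta>(x)\<close>. Since the elements of the Lie algebra are primitive, \<open>r\<^sub>i\<^sub>,\<^sub>j + r\<^sub>i\<^sub>,\<^sub>k\<close> is a sum of products
  \<open>a\<^sub>i \<Delta>(b)\<^sub>j\<^sub>,\<^sub>k\<close> and so commutes with \<open>s\<^sub>j\<^sub>,\<^sub>k\<close>; similarly \<open>r\<^sub>i\<^sub>,\<^sub>k + r\<^sub>j\<^sub>,\<^sub>k\<close> commutes with \<open>s\<^sub>i\<^sub>,\<^sub>j\<close>. Hence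
  the left-hand side does not change when all three r-matrices are replaced by \<open>r\<^bsup>(c')\<^esup>\<close>, and it
  is then the image of the classical Yang-Baxter equation under the automorphism of
  \<open>U(\<gg>)\<^bsup>\<otimes>3\<^esup>\<close> permuting the tensor factors.
\<close>

section \<open>Tensor products of spaces and algebras\<close>

text \<open>\<open>tensor_lift\<close> and \<open>comult\<close> are Hilbert choices, so nothing can
  be said about them before a map with the prescribed values is exhibited. This is why universal
  properties are developed before any r-matrix appears: that of the tensor product, for spaces and
  then for algebras, and that of \<open>U\<close>, by evaluation of noncommutative polynomials.
  Afterwards \<open>comult\<close> enters only through its values on the elements
  \<open>\<iota> x\<close>.

  The condition c' \<in> {c, c''} comes from a cross term. Put r = r' + s and r'' = r' + t with s
  and t commuting with all \<Delta>(x). The left-hand side expands to the Yang-Baxter expression of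
  r', the terms [s_ij, r'_ik + r'_jk] and [r'_ij + r'_ik, t_jk], which vanish, and [s_ij, t_jk]. The
  last one can survive: for the standard r' of sl_2 with Casimir tensor \<Omega> = r' + r'_21, the
  choice r = r'' = r' - \<Omega> leaves [\<Omega>_ij, \<Omega>_jk], which is not zero. The condition
  makes s or t zero.\<close>

text \<open>
  The scalars range over a type, as in the definition of the tensor product; this is why the
  library locale for modules, whose scalars form a ring record, is not used.
\<close>

locale linear_space = abelian_group A for A :: "('k::field, 'a) module" (structure) +
  assumes smult_closed [simp, intro]: "a \<in> carrier A \<Longrightarrow> c \<odot> a \<in> carrier A"
    and smult_r_distr: "a \<in> carrier A \<Longrightarrow> b \<in> carrier A \<Longrightarrow> c \<odot> (a \<oplus> b) = c \<odot> a \<oplus> c \<odot> b"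
    and smult_l_distr: "a \<in> carrier A \<Longrightarrow> (c + d) \<odot> a = c \<odot> a \<oplus> d \<odot> a"
    and smult_assoc: "a \<in> carrier A \<Longrightarrow> (c * d) \<odot> a = c \<odot> (d \<odot> a)"
    and smult_one: "a \<in> carrier A \<Longrightarrow> 1 \<odot> a = a"

locale assoc_algebra = linear_space A + ring A for A :: "('k::field, 'a) module" (structure) +
  assumes smult_mult_left: "a \<in> carrier A \<Longrightarrow> b \<in> carrier A \<Longrightarrow> (c \<odot> a) \<otimes> b = c \<odot> (a \<otimes> b)"
    and smult_mult_right: "a \<in> carrier A \<Longrightarrow> b \<in> carrier A \<Longrightarrow> a \<otimes> (c \<odot> b) = c \<odot> (a \<otimes> b)"

section \<open>Algebra homomorphisms and additive maps\<close>

definition algebra_hom ::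
  "('k, 'a) module \<Rightarrow> ('k, 'b) module \<Rightarrow> ('a \<Rightarrow> 'b) set" where
  "algebra_hom A B = {h \<in> ring_hom A B. \<forall>c. \<forall>a\<in>carrier A. h (c \<odot>\<^bsub>A\<^esub> a) = c \<odot>\<^bsub>B\<^esub> h a}"

lemma algebra_homD:
  assumes "h \<in> algebra_hom A B"
  shows "a \<in> carrier A \<Longrightarrow> h a \<in> carrier B"
    and "a \<in> carrier A \<Longrightarrow> b \<in> carrier A \<Longrightarrow> h (a \<oplus>\<^bsub>A\<^esub> b) = h a \<oplus>\<^bsub>B\<^esub> h b"
    and "a \<in> carrier A \<Longrightarrow> b \<in> carrier A \<Longrightarrow> h (a \<otimes>\<^bsub>A\<^esub> b) = h a \<otimes>\<^bsub>B\<^esub> h b"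
    and "h \<one>\<^bsub>A\<^esub> = \<one>\<^bsub>B\<^esub>"
    and "a \<in> carrier A \<Longrightarrow> h (c \<odot>\<^bsub>A\<^esub> a) = c \<odot>\<^bsub>B\<^esub> h a"
  using assms unfolding algebra_hom_def ring_hom_def by auto

lemma algebra_homI:
  assumes "\<And>a. a \<in> carrier A \<Longrightarrow> h a \<in> carrier B"
    and "\<And>a b. a \<in> carrier A \<Longrightarrow> b \<in> carrier A \<Longrightarrow> h (a \<oplus>\<^bsub>A\<^esub> b) = h a \<oplus>\<^bsub>B\<^esub> h b"
    and "\<And>a b. a \<in> carrier A \<Longrightarrow> b \<in> carrier A \<Longrightarrow> h (a \<otimes>\<^bsub>A\<^esub> b) = h a \<otimes>\<^bsub>B\<^esub> h b"
    and "h \<one>\<^bsub>A\<^esub> = \<one>\<^bsub>B\<^esub>"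
    and "\<And>c a. a \<in> carrier A \<Longrightarrow> h (c \<odot>\<^bsub>A\<^esub> a) = c \<odot>\<^bsub>B\<^esub> h a"
  shows "h \<in> algebra_hom A B"
  using assms unfolding algebra_hom_def ring_hom_def by auto

lemma algebra_hom_comp:
  assumes "g \<in> algebra_hom A B" and "h \<in> algebra_hom B C"
  shows "(\<lambda>a. h (g a)) \<in> algebra_hom A C"
  by (intro algebra_homI) (simp_all add: algebra_homD[OF assms(1)] algebra_homD[OF assms(2)])

lemma additive_zero:
  assumes "abelian_group A" "abelian_group B" and h: "h \<in> hom (add_monoid A) (add_monoid B)"
  shows "h \<zero>\<^bsub>A\<^esub> = \<zero>\<^bsub>B\<^esub>"
  using group_hom.hom_one[of "add_monoid A" "add_monoid B" h] assms
  by (simp add: group_hom_def group_hom_axioms_def abelian_group.a_group)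

lemma additive_minus:
  assumes A: "abelian_group A" and B: "abelian_group B"
    and h: "h \<in> hom (add_monoid A) (add_monoid B)" and ab: "a \<in> carrier A" "b \<in> carrier A"
  shows "h (a \<ominus>\<^bsub>A\<^esub> b) = h a \<ominus>\<^bsub>B\<^esub> h b"
proof -
  interpret h: group_hom "add_monoid A" "add_monoid B" h
    using A B h by (simp add: group_hom_def group_hom_axioms_def abelian_group.a_group)
  have "\<ominus>\<^bsub>A\<^esub> b \<in> carrier A" by (simp add: A abelian_group.a_inv_closed ab)
  then show ?thesis
    using h.hom_mult[of a "\<ominus>\<^bsub>A\<^esub> b"] h.hom_inv[of b] ab
    by (simp add: a_minus_def a_inv_def)
qed

section \<open>The tensor product of two vector spaces\<close>

lemma tensor_simps:
  "carrier (tensor A B) = carrier (tensor_group A B)"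
  "a \<oplus>\<^bsub>tensor A B\<^esub> b = a \<otimes>\<^bsub>tensor_group A B\<^esub> b"
  "\<zero>\<^bsub>tensor A B\<^esub> = \<one>\<^bsub>tensor_group A B\<^esub>"
  "\<one>\<^bsub>tensor A B\<^esub> = pure_tensor A B \<one>\<^bsub>A\<^esub> \<one>\<^bsub>B\<^esub>"
  by (simp_all add: tensor_def tensor_add_ring_def Let_def)

text \<open>\<open>tensor_lift\<close> reads only the carrier and the addition of its target. The
  auxiliary record used inside the definition of \<open>tensor\<close> therefore gives literally the
  same choice as the finished tensor product, for which the algebraic laws are available.\<close>

lemma tensor_lift_tensor_add_ring:
  "tensor_lift A B (tensor_add_ring A' B') f = tensor_lift A B (tensor A' B') f"
  by (simp add: tensor_lift_def hom_def tensor_simps tensor_add_ring_def)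

lemma hom_tensor_group: "hom (tensor_group A B) G = hom (add_monoid (tensor A B)) G"
  by (simp add: hom_def tensor_simps)

locale two_spaces = A: linear_space A + B: linear_space B
  for A :: "('k::field, 'a) module" and B :: "('k, 'b) module"
begin

abbreviation T where "T \<equiv> tensor A B"

abbreviation F where "F \<equiv> free_Abelian_group (carrier A \<times> carrier B)"

sublocale T: abelian_group T
proof -
  interpret F: comm_group F by (rule abelian_free_Abelian_group)
  have "subgroup (tensor_kernel A B) F"
    using tensor_kernel_normal(2)[OF A.abelian_group_axioms _ B.abelian_group_axioms]
    by (simp add: normal_imp_subgroup)
  then interpret G: comm_group "tensor_group A B"
    unfolding tensor_group_def by (rule F.abelian_FactGroup)
  show "abelian_group T"
    by (rule abelian_groupI) (simp_all add: tensor_simps G.m_assoc G.l_inv_ex, simp add: G.m_comm)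
qed

lemma kernel_normal: "tensor_kernel A B \<lhd> F"
  using tensor_kernel_normal(2)[OF A.abelian_group_axioms _ B.abelian_group_axioms] by simp

text \<open>The conclusions are bundled because they share one set of premises: for each concrete
  map below, one pass of \<open>rule lift\<close> with \<open>simp\<close> checks that its
  prescription is biadditive and balanced and delivers closure, additivity and values
  together.\<close>

lemma lift:
  assumes C: "abelian_group C"
    and "\<And>a b. a \<in> carrier A \<Longrightarrow> b \<in> carrier B \<Longrightarrow> f a b \<in> carrier C"
    and "\<And>a a' b. a \<in> carrier A \<Longrightarrow> a' \<in> carrier A \<Longrightarrow> b \<in> carrier B \<Longrightarrow>
           f (a \<oplus>\<^bsub>A\<^esub> a') b = f a b \<oplus>\<^bsub>C\<^esub> f a' b"
    and "\<And>a b b'. a \<in> carrier A \<Longrightarrow> b \<in> carrier B \<Longrightarrow> b' \<in> carrier B \<Longrightarrow>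
           f a (b \<oplus>\<^bsub>B\<^esub> b') = f a b \<oplus>\<^bsub>C\<^esub> f a b'"
    and "\<And>c a b. a \<in> carrier A \<Longrightarrow> b \<in> carrier B \<Longrightarrow> f (c \<odot>\<^bsub>A\<^esub> a) b = f a (c \<odot>\<^bsub>B\<^esub> b)"
  shows lift_hom: "tensor_lift A B C f \<in> hom (add_monoid T) (add_monoid C)"
    and lift_closed: "t \<in> carrier T \<Longrightarrow> tensor_lift A B C f t \<in> carrier C"
    and lift_add: "s \<in> carrier T \<Longrightarrow> t \<in> carrier T \<Longrightarrow>
          tensor_lift A B C f (s \<oplus>\<^bsub>T\<^esub> t) = tensor_lift A B C f s \<oplus>\<^bsub>C\<^esub> tensor_lift A B C f t"
    and lift_zero: "tensor_lift A B C f \<zero>\<^bsub>T\<^esub> = \<zero>\<^bsub>C\<^esub>"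
    and lift_pure: "\<And>a b. a \<in> carrier A \<Longrightarrow> b \<in> carrier B \<Longrightarrow>
           tensor_lift A B C f (pure_tensor A B a b) = f a b"
proof -
  have *: "tensor_lift A B C f \<in> hom (add_monoid T) (add_monoid C)"
    unfolding hom_tensor_group[symmetric]
    using assms by (intro tensor_lift(1) A.abelian_group_axioms B.abelian_group_axioms) auto
  then show "tensor_lift A B C f \<in> hom (add_monoid T) (add_monoid C)" .
  show "t \<in> carrier T \<Longrightarrow> tensor_lift A B C f t \<in> carrier C"
    and "s \<in> carrier T \<Longrightarrow> t \<in> carrier T \<Longrightarrow>
          tensor_lift A B C f (s \<oplus>\<^bsub>T\<^esub> t) = tensor_lift A B C f s \<oplus>\<^bsub>C\<^esub> tensor_lift A B C f t"
    using * by (auto simp: hom_def tensor_simps)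
  show "tensor_lift A B C f \<zero>\<^bsub>T\<^esub> = \<zero>\<^bsub>C\<^esub>"
    using T.abelian_group_axioms C * by (rule additive_zero)
  show "\<And>a b. a \<in> carrier A \<Longrightarrow> b \<in> carrier B \<Longrightarrow>
           tensor_lift A B C f (pure_tensor A B a b) = f a b"
    using assms by (intro tensor_lift(2) A.abelian_group_axioms B.abelian_group_axioms) auto
qed

definition proj where "proj x = tensor_kernel A B #>\<^bsub>F\<^esub> x"

lemma pure_eq_proj: "pure_tensor A B a b = proj (frag_of (a, b))"
  by (simp add: pure_tensor_def proj_def)

lemma group_hom_proj: "group_hom F (add_monoid T) proj"
proof -
  interpret F: comm_group F by (rule abelian_free_Abelian_group)
  show ?thesis
    using normal.r_coset_hom_Mod[OF kernel_normal] T.a_group F.group_axioms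
    by (auto simp: group_hom_def group_hom_axioms_def hom_def tensor_simps tensor_group_def proj_def[abs_def])
qed

lemma frag_diff_closed: "x \<in> carrier F \<Longrightarrow> y \<in> carrier F \<Longrightarrow> x - y \<in> carrier F"
  using keys_diff[of x y] by auto

lemma proj_closed: "x \<in> carrier F \<Longrightarrow> proj x \<in> carrier T"
  using group_hom.hom_closed[OF group_hom_proj] by (simp add: tensor_simps)

lemma proj_diff:
  assumes "x \<in> carrier F" "y \<in> carrier F"
  shows "proj (x - y) = proj x \<ominus>\<^bsub>T\<^esub> proj y"
proof -
  interpret p: group_hom F "add_monoid T" proj by (rule group_hom_proj)
  have "proj (x - y) = proj (x \<otimes>\<^bsub>F\<^esub> inv\<^bsub>F\<^esub> y)" using assms by simp
  also have "\<dots> = proj x \<oplus>\<^bsub>T\<^esub> proj (inv\<^bsub>F\<^esub> y)"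
    using p.hom_mult[OF assms(1) group.inv_closed[OF group_free_Abelian_group assms(2)]] by (simp add: tensor_simps del: inv_free_Abelian_group)
  also have "proj (inv\<^bsub>F\<^esub> y) = \<ominus>\<^bsub>T\<^esub> proj y"
    using p.hom_inv[of y] assms by (simp add: a_inv_def)
  finally show ?thesis by (simp add: a_minus_def)
qed

lemma frag_of_closed: "a \<in> carrier A \<Longrightarrow> b \<in> carrier B \<Longrightarrow> frag_of (a, b) \<in> carrier F"
  by simp

lemma pure_closed [simp]: "a \<in> carrier A \<Longrightarrow> b \<in> carrier B \<Longrightarrow> pure_tensor A B a b \<in> carrier T"
  unfolding pure_eq_proj by (intro proj_closed frag_of_closed)

text \<open>Through this, each of the three families in \<open>tensor_relations\<close> becomes one
  of the three laws of pure tensors below.\<close>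

lemma proj_relation:
  assumes "x \<in> tensor_relations A B"
  shows "proj x = \<zero>\<^bsub>T\<^esub>"
proof -
  have "x \<in> tensor_kernel A B"
    unfolding tensor_kernel_def using assms by (rule generate.incl)
  then have "proj x = tensor_kernel A B"
    unfolding proj_def using kernel_normal
    by (metis group.coset_join2 group_free_Abelian_group normal_imp_subgroup subgroup.mem_carrier)
  then show ?thesis by (simp add: tensor_simps tensor_group_def)
qed

lemma minus_minus_zeroD:
  assumes "u \<ominus>\<^bsub>T\<^esub> v \<ominus>\<^bsub>T\<^esub> w = \<zero>\<^bsub>T\<^esub>" "u \<in> carrier T" "v \<in> carrier T" "w \<in> carrier T"
  shows "u = v \<oplus>\<^bsub>T\<^esub> w"
proof -
  have "u = u \<ominus>\<^bsub>T\<^esub> v \<ominus>\<^bsub>T\<^esub> w \<oplus>\<^bsub>T\<^esub> (w \<oplus>\<^bsub>T\<^esub> v)"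
    using assms(2-) by (simp add: a_minus_def T.a_assoc T.r_neg1 T.l_neg T.r_neg2)
  then show ?thesis using assms by (simp add: T.a_comm)
qed

lemma pure_add_left:
  assumes "a \<in> carrier A" "a' \<in> carrier A" "b \<in> carrier B"
  shows "pure_tensor A B (a \<oplus>\<^bsub>A\<^esub> a') b = pure_tensor A B a b \<oplus>\<^bsub>T\<^esub> pure_tensor A B a' b"
proof -
  have "proj (frag_of (a \<oplus>\<^bsub>A\<^esub> a', b) - frag_of (a, b) - frag_of (a', b)) = \<zero>\<^bsub>T\<^esub>"
    using assms by (intro proj_relation) (auto simp: tensor_relations_def)
  then show ?thesis
    using assms by (intro minus_minus_zeroD) (simp_all only: proj_diff frag_of_closed
      frag_diff_closed A.a_closed pure_closed pure_eq_proj[symmetric])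
qed

lemma pure_add_right:
  assumes "a \<in> carrier A" "b \<in> carrier B" "b' \<in> carrier B"
  shows "pure_tensor A B a (b \<oplus>\<^bsub>B\<^esub> b') = pure_tensor A B a b \<oplus>\<^bsub>T\<^esub> pure_tensor A B a b'"
proof -
  have "proj (frag_of (a, b \<oplus>\<^bsub>B\<^esub> b') - frag_of (a, b) - frag_of (a, b')) = \<zero>\<^bsub>T\<^esub>"
    using assms by (intro proj_relation) (auto simp: tensor_relations_def)
  then show ?thesis
    using assms by (intro minus_minus_zeroD) (simp_all only: proj_diff frag_of_closed
      frag_diff_closed B.a_closed pure_closed pure_eq_proj[symmetric])
qed

lemma pure_balanced:
  assumes "a \<in> carrier A" "b \<in> carrier B"
  shows "pure_tensor A B (c \<odot>\<^bsub>A\<^esub> a) b = pure_tensor A B a (c \<odot>\<^bsub>B\<^esub> b)"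
proof -
  have "proj (frag_of (c \<odot>\<^bsub>A\<^esub> a, b) - frag_of (a, c \<odot>\<^bsub>B\<^esub> b)) = \<zero>\<^bsub>T\<^esub>"
    using assms by (intro proj_relation) (auto simp: tensor_relations_def)
  then have "pure_tensor A B (c \<odot>\<^bsub>A\<^esub> a) b \<ominus>\<^bsub>T\<^esub> pure_tensor A B a (c \<odot>\<^bsub>B\<^esub> b) = \<zero>\<^bsub>T\<^esub>"
    using assms by (simp only: proj_diff frag_of_closed A.smult_closed B.smult_closed pure_eq_proj)
  then show ?thesis
    using assms minus_minus_zeroD[of _ _ "\<zero>\<^bsub>T\<^esub>"] by (simp add: a_minus_def)
qed

lemma pure_zero_left: "b \<in> carrier B \<Longrightarrow> pure_tensor A B \<zero>\<^bsub>A\<^esub> b = \<zero>\<^bsub>T\<^esub>"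
  using pure_add_left[of "\<zero>\<^bsub>A\<^esub>" "\<zero>\<^bsub>A\<^esub>" b] T.add.l_cancel_one[of "pure_tensor A B \<zero>\<^bsub>A\<^esub> b" "pure_tensor A B \<zero>\<^bsub>A\<^esub> b"]
  by simp

lemma pure_neg_left:
  assumes "a \<in> carrier A" "b \<in> carrier B"
  shows "pure_tensor A B (\<ominus>\<^bsub>A\<^esub> a) b = \<ominus>\<^bsub>T\<^esub> pure_tensor A B a b"
  using pure_add_left[of "\<ominus>\<^bsub>A\<^esub> a" a b] assms
  by (intro T.minus_equality[symmetric]) (simp_all add: A.l_neg pure_zero_left)

text \<open>Every tensor is a finite sum of pure tensors. No case for negation is needed, since the
  negative of a pure tensor is again pure, by \<open>pure_neg_left\<close>.\<close>

lemma tensor_induct [consumes 1, case_names zero pure add]: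
  assumes t: "t \<in> carrier T"
    and zero: "P \<zero>\<^bsub>T\<^esub>"
    and pure: "\<And>a b. a \<in> carrier A \<Longrightarrow> b \<in> carrier B \<Longrightarrow> P (pure_tensor A B a b)"
    and add: "\<And>s t. s \<in> carrier T \<Longrightarrow> t \<in> carrier T \<Longrightarrow> P s \<Longrightarrow> P t \<Longrightarrow> P (s \<oplus>\<^bsub>T\<^esub> t)"
  shows "P t"
proof -
  obtain x where x: "x \<in> carrier F" "t = proj x"
    using t by (auto simp: tensor_simps tensor_group_def carrier_FactGroup proj_def)
  have "Poly_Mapping.keys x \<subseteq> carrier A \<times> carrier B" using x by simp
  \<comment> \<open>\<open>frag_induction\<close> builds the free abelian group by differences,
    while \<open>add\<close> handles sums only. Carrying \<open>P\<close> for the negative as well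
    turns x - y into the sum of x and -y, and its negative into the sum of -x and y.\<close>
  then have "x \<in> carrier F \<and> P (proj x) \<and> P (\<ominus>\<^bsub>T\<^esub> proj x)"
  proof (induction x rule: frag_induction)
    case zero
    have "proj 0 = \<zero>\<^bsub>T\<^esub>"
      using group_hom.hom_one[OF group_hom_proj] by (simp add: tensor_simps)
    then show ?case using assms(2) by (simp add: T.minus_equality[of "\<zero>\<^bsub>T\<^esub>" "\<zero>\<^bsub>T\<^esub>"])
  next
    case (one x)
    then obtain a b where "x = (a, b)" "a \<in> carrier A" "b \<in> carrier B" by auto
    then show ?case
      using pure[of a b] pure[of "\<ominus>\<^bsub>A\<^esub> a" b] by (simp add: pure_neg_left flip: pure_eq_proj)
  next
    case (diff x y)
    note * = diff proj_closed[of x] proj_closed[of y]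
    have "\<ominus>\<^bsub>T\<^esub> (proj x \<ominus>\<^bsub>T\<^esub> proj y) = \<ominus>\<^bsub>T\<^esub> proj x \<oplus>\<^bsub>T\<^esub> proj y"
      using * by (simp add: a_minus_def T.minus_add)
    then show ?case
      using * frag_diff_closed[of x y] add[of "proj x" "\<ominus>\<^bsub>T\<^esub> proj y"] add[of "\<ominus>\<^bsub>T\<^esub> proj x" "proj y"]
      by (simp add: proj_diff a_minus_def del: carrier_free_Abelian_group_iff)
  qed
  then show ?thesis using x by simp
qed

lemma tensor_smult_hom:
  shows smult_closed_T: "t \<in> carrier T \<Longrightarrow> c \<odot>\<^bsub>T\<^esub> t \<in> carrier T"
    and smult_add_T: "s \<in> carrier T \<Longrightarrow> t \<in> carrier T \<Longrightarrow> c \<odot>\<^bsub>T\<^esub> (s \<oplus>\<^bsub>T\<^esub> t) = c \<odot>\<^bsub>T\<^esub> s \<oplus>\<^bsub>T\<^esub> c \<odot>\<^bsub>T\<^esub> t"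
    and smult_zero_T: "c \<odot>\<^bsub>T\<^esub> \<zero>\<^bsub>T\<^esub> = \<zero>\<^bsub>T\<^esub>"
    and smult_pure: "a \<in> carrier A \<Longrightarrow> b \<in> carrier B \<Longrightarrow>
        c \<odot>\<^bsub>T\<^esub> pure_tensor A B a b = pure_tensor A B (c \<odot>\<^bsub>A\<^esub> a) b"
proof -
  have eq: "c \<odot>\<^bsub>T\<^esub> t = tensor_lift A B T (\<lambda>a b. pure_tensor A B (c \<odot>\<^bsub>A\<^esub> a) b) t" for t
    unfolding tensor_lift_tensor_add_ring[symmetric] by (simp add: tensor_def Let_def)
  \<comment> \<open>The scalar c already occupies the first factor. Moving d past it to the second
    factor uses that the field is commutative.\<close>
  have bal: "pure_tensor A B (c \<odot>\<^bsub>A\<^esub> (d \<odot>\<^bsub>A\<^esub> a)) b = pure_tensor A B (c \<odot>\<^bsub>A\<^esub> a) (d \<odot>\<^bsub>B\<^esub> b)"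
    if "a \<in> carrier A" "b \<in> carrier B" for d a b
  proof -
    have "c \<odot>\<^bsub>A\<^esub> (d \<odot>\<^bsub>A\<^esub> a) = d \<odot>\<^bsub>A\<^esub> (c \<odot>\<^bsub>A\<^esub> a)"
      using that by (simp add: A.smult_assoc[symmetric] mult.commute)
    then show ?thesis using that by (simp add: pure_balanced)
  qed
  show "t \<in> carrier T \<Longrightarrow> c \<odot>\<^bsub>T\<^esub> t \<in> carrier T"
    "s \<in> carrier T \<Longrightarrow> t \<in> carrier T \<Longrightarrow> c \<odot>\<^bsub>T\<^esub> (s \<oplus>\<^bsub>T\<^esub> t) = c \<odot>\<^bsub>T\<^esub> s \<oplus>\<^bsub>T\<^esub> c \<odot>\<^bsub>T\<^esub> t"
    "c \<odot>\<^bsub>T\<^esub> \<zero>\<^bsub>T\<^esub> = \<zero>\<^bsub>T\<^esub>"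
    "a \<in> carrier A \<Longrightarrow> b \<in> carrier B \<Longrightarrow>
        c \<odot>\<^bsub>T\<^esub> pure_tensor A B a b = pure_tensor A B (c \<odot>\<^bsub>A\<^esub> a) b"
    unfolding eq
    by (rule lift[OF T.abelian_group_axioms];
        simp add: pure_add_left pure_add_right bal A.smult_r_distr)+
qed


sublocale T: linear_space T
proof
  fix c d :: 'k and s t
  show "t \<in> carrier T \<Longrightarrow> c \<odot>\<^bsub>T\<^esub> t \<in> carrier T"
    and "s \<in> carrier T \<Longrightarrow> t \<in> carrier T \<Longrightarrow> c \<odot>\<^bsub>T\<^esub> (s \<oplus>\<^bsub>T\<^esub> t) = c \<odot>\<^bsub>T\<^esub> s \<oplus>\<^bsub>T\<^esub> c \<odot>\<^bsub>T\<^esub> t"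
    by (fact smult_closed_T smult_add_T)+
  show "(c + d) \<odot>\<^bsub>T\<^esub> t = c \<odot>\<^bsub>T\<^esub> t \<oplus>\<^bsub>T\<^esub> d \<odot>\<^bsub>T\<^esub> t" if "t \<in> carrier T"
    using that
  proof (induction t rule: tensor_induct)
    case (add s t)
    then show ?case
      by (simp add: smult_add_T smult_closed_T T.a_ac)
  qed (simp_all add: smult_pure smult_zero_T A.smult_l_distr pure_add_left)
  show "(c * d) \<odot>\<^bsub>T\<^esub> t = c \<odot>\<^bsub>T\<^esub> (d \<odot>\<^bsub>T\<^esub> t)" if "t \<in> carrier T"
    using that
    by (induction t rule: tensor_induct)
      (simp_all add: smult_add_T smult_closed_T smult_pure smult_zero_T A.smult_assoc)
  show "1 \<odot>\<^bsub>T\<^esub> t = t" if "t \<in> carrier T"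
    using that
    by (induction t rule: tensor_induct)
      (simp_all add: smult_add_T smult_closed_T smult_pure smult_zero_T A.smult_one)
qed

end

section \<open>The tensor product of two algebras\<close>

locale two_algebras = A: assoc_algebra A + B: assoc_algebra B
  for A :: "('k::field, 'a) module" and B :: "('k, 'b) module"

sublocale two_algebras \<subseteq> two_spaces ..

context two_algebras
begin

text \<open>The inner of the two nested lifts that define the product. The outer lift makes sense
  only if this value is biadditive and balanced in \<open>(a, b)\<close> for fixed \<open>t\<close>;
  the three lemmas after \<open>left_mult_hom\<close> prove that by induction on
  \<open>t\<close>.\<close>

definition left_mult where
  "left_mult a b = tensor_lift A B T (\<lambda>a' b'. pure_tensor A B (a \<otimes>\<^bsub>A\<^esub> a') (b \<otimes>\<^bsub>B\<^esub> b'))"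

lemma tensor_mult: "s \<otimes>\<^bsub>T\<^esub> t = tensor_lift A B T (\<lambda>a b. left_mult a b t) s"
  unfolding left_mult_def tensor_lift_tensor_add_ring[symmetric]
  by (simp add: tensor_def Let_def)

lemma left_mult_hom:
  assumes ab: "a \<in> carrier A" "b \<in> carrier B"
  shows left_mult_closed: "t \<in> carrier T \<Longrightarrow> left_mult a b t \<in> carrier T"
    and left_mult_add: "s \<in> carrier T \<Longrightarrow> t \<in> carrier T \<Longrightarrow>
      left_mult a b (s \<oplus>\<^bsub>T\<^esub> t) = left_mult a b s \<oplus>\<^bsub>T\<^esub> left_mult a b t"
    and left_mult_zero: "left_mult a b \<zero>\<^bsub>T\<^esub> = \<zero>\<^bsub>T\<^esub>"
    and left_mult_pure: "\<And>a' b'. a' \<in> carrier A \<Longrightarrow> b' \<in> carrier B \<Longrightarrow>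
      left_mult a b (pure_tensor A B a' b') = pure_tensor A B (a \<otimes>\<^bsub>A\<^esub> a') (b \<otimes>\<^bsub>B\<^esub> b')"
  unfolding left_mult_def using ab
  by - (rule lift[OF T.abelian_group_axioms]; simp add: A.r_distr B.r_distr pure_add_left
      pure_add_right A.smult_mult_right B.smult_mult_right pure_balanced)+

lemma left_mult_add1:
  assumes "t \<in> carrier T" "a \<in> carrier A" "a' \<in> carrier A" "b \<in> carrier B"
  shows "left_mult (a \<oplus>\<^bsub>A\<^esub> a') b t = left_mult a b t \<oplus>\<^bsub>T\<^esub> left_mult a' b t"
  using assms
  by (induction t rule: tensor_induct)
    (simp_all add: left_mult_hom A.l_distr pure_add_left T.a_ac)

lemma left_mult_add2:
  assumes "t \<in> carrier T" "a \<in> carrier A" "b \<in> carrier B" "b' \<in> carrier B"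
  shows "left_mult a (b \<oplus>\<^bsub>B\<^esub> b') t = left_mult a b t \<oplus>\<^bsub>T\<^esub> left_mult a b' t"
  using assms
  by (induction t rule: tensor_induct)
    (simp_all add: left_mult_hom B.l_distr pure_add_right T.a_ac)

lemma left_mult_balanced:
  assumes "t \<in> carrier T" "a \<in> carrier A" "b \<in> carrier B"
  shows "left_mult (c \<odot>\<^bsub>A\<^esub> a) b t = left_mult a (c \<odot>\<^bsub>B\<^esub> b) t"
  using assms
  by (induction t rule: tensor_induct)
    (simp_all add: left_mult_hom A.smult_mult_left B.smult_mult_left pure_balanced)

lemma tensor_mult_hom:
  assumes t: "t \<in> carrier T"
  shows mult_closed: "s \<in> carrier T \<Longrightarrow> s \<otimes>\<^bsub>T\<^esub> t \<in> carrier T"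
    and mult_add_left: "s \<in> carrier T \<Longrightarrow> s' \<in> carrier T \<Longrightarrow>
      (s \<oplus>\<^bsub>T\<^esub> s') \<otimes>\<^bsub>T\<^esub> t = s \<otimes>\<^bsub>T\<^esub> t \<oplus>\<^bsub>T\<^esub> s' \<otimes>\<^bsub>T\<^esub> t"
    and mult_zero_left: "\<zero>\<^bsub>T\<^esub> \<otimes>\<^bsub>T\<^esub> t = \<zero>\<^bsub>T\<^esub>"
    and mult_pure_left: "a \<in> carrier A \<Longrightarrow> b \<in> carrier B \<Longrightarrow>
      pure_tensor A B a b \<otimes>\<^bsub>T\<^esub> t = left_mult a b t"
  unfolding tensor_mult using t
  by - (rule lift[OF T.abelian_group_axioms];
      simp add: left_mult_closed left_mult_add1 left_mult_add2 left_mult_balanced)+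

text \<open>The outer lift controls the left argument only. Additivity on the right is inherited
  from \<open>left_mult\<close> by decomposing the left argument.\<close>

lemma mult_add_right:
  assumes "s \<in> carrier T" "t \<in> carrier T" "t' \<in> carrier T"
  shows "s \<otimes>\<^bsub>T\<^esub> (t \<oplus>\<^bsub>T\<^esub> t') = s \<otimes>\<^bsub>T\<^esub> t \<oplus>\<^bsub>T\<^esub> s \<otimes>\<^bsub>T\<^esub> t'"
  using assms
  by (induction s rule: tensor_induct) (simp_all add: tensor_mult_hom left_mult_hom T.a_ac)

lemma mult_zero_right:
  assumes "s \<in> carrier T"
  shows "s \<otimes>\<^bsub>T\<^esub> \<zero>\<^bsub>T\<^esub> = \<zero>\<^bsub>T\<^esub>"
  using assms
  by (induction s rule: tensor_induct) (simp_all add: tensor_mult_hom left_mult_hom)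

lemma mult_pure_pure:
  assumes "a \<in> carrier A" "b \<in> carrier B" "a' \<in> carrier A" "b' \<in> carrier B"
  shows "pure_tensor A B a b \<otimes>\<^bsub>T\<^esub> pure_tensor A B a' b'
    = pure_tensor A B (a \<otimes>\<^bsub>A\<^esub> a') (b \<otimes>\<^bsub>B\<^esub> b')"
  using assms by (simp add: mult_pure_left left_mult_pure)

lemmas mult_simps = mult_closed mult_add_left mult_add_right mult_zero_left mult_zero_right
  mult_pure_pure tensor_simps(4)

text \<open>Both sides of each law are additive in every tensor argument, so nested inductions
  reduce the law to pure tensors, where it holds factor by factor.\<close>

sublocale T: assoc_algebra T
proof -
  have smult_left: "c \<odot>\<^bsub>T\<^esub> s \<otimes>\<^bsub>T\<^esub> t = c \<odot>\<^bsub>T\<^esub> (s \<otimes>\<^bsub>T\<^esub> t)"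
    if s: "s \<in> carrier T" and t: "t \<in> carrier T" for c s t
    using s
  proof (induction s rule: tensor_induct)
    case (pure a b)
    with t show ?case
      by (induction t rule: tensor_induct)
        (simp_all add: mult_simps smult_pure smult_add_T smult_zero_T A.smult_mult_left)
  qed (use t in \<open>simp_all add: mult_simps smult_add_T smult_zero_T\<close>)
  have smult_right: "s \<otimes>\<^bsub>T\<^esub> (c \<odot>\<^bsub>T\<^esub> t) = c \<odot>\<^bsub>T\<^esub> (s \<otimes>\<^bsub>T\<^esub> t)"
    if s: "s \<in> carrier T" and t: "t \<in> carrier T" for c s t
    using s
  proof (induction s rule: tensor_induct)
    case (pure a b)
    with t show ?case
      by (induction t rule: tensor_induct)
        (simp_all add: mult_simps smult_pure smult_add_T smult_zero_T A.smult_mult_right)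
  qed (use t in \<open>simp_all add: mult_simps smult_add_T smult_zero_T\<close>)
  have assoc: "s \<otimes>\<^bsub>T\<^esub> t \<otimes>\<^bsub>T\<^esub> u = s \<otimes>\<^bsub>T\<^esub> (t \<otimes>\<^bsub>T\<^esub> u)"
    if s: "s \<in> carrier T" and t: "t \<in> carrier T" and u: "u \<in> carrier T" for s t u
    using s
  proof (induction s rule: tensor_induct)
    case s: (pure a b)
    show ?case using t
    proof (induction t rule: tensor_induct)
      case (pure a' b')
      show ?case using u s pure
        by (induction u rule: tensor_induct)
          (simp_all add: mult_simps A.m_assoc B.m_assoc)
    qed (use s u in \<open>simp_all add: mult_simps\<close>)
  qed (use t u in \<open>simp_all add: mult_simps\<close>)
  have one: "s \<otimes>\<^bsub>T\<^esub> \<one>\<^bsub>T\<^esub> = s \<and> \<one>\<^bsub>T\<^esub> \<otimes>\<^bsub>T\<^esub> s = s" if s: "s \<in> carrier T" for s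
    using s by (induction s rule: tensor_induct) (simp_all add: mult_simps)
  have one_closed: "\<one>\<^bsub>T\<^esub> \<in> carrier T"
    by (simp add: tensor_simps(4))
  have "ring T"
    by (rule ringI; (rule T.abelian_group_axioms monoidI)?)
      (simp_all add: mult_closed mult_add_left mult_add_right assoc one one_closed)
  then interpret ring T .
  show "assoc_algebra T"
    by unfold_locales (simp_all add: smult_left smult_right)
qed

lemma smult_pure_right: "a \<in> carrier A \<Longrightarrow> b \<in> carrier B \<Longrightarrow>
    c \<odot>\<^bsub>T\<^esub> pure_tensor A B a b = pure_tensor A B a (c \<odot>\<^bsub>B\<^esub> b)"
  by (simp add: smult_pure pure_balanced)

lemma tensor_left_hom: "(\<lambda>a. pure_tensor A B a \<one>\<^bsub>B\<^esub>) \<in> algebra_hom A T"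
  by (rule algebra_homI) (simp_all add: pure_add_left mult_pure_pure tensor_simps(4) smult_pure)

lemma tensor_right_hom: "(\<lambda>b. pure_tensor A B \<one>\<^bsub>A\<^esub> b) \<in> algebra_hom B T"
  by (rule algebra_homI)
    (simp_all add: pure_add_right mult_pure_pure tensor_simps(4) smult_pure_right)

text \<open>Commuting images let \<open>g b\<close> pass \<open>f a'\<close>, which is what makes
  the product prescription multiplicative. Both the placement of \<open>U2\<close> inside
  \<open>U3\<close> and the permutations of the factors of \<open>U3\<close> are obtained from
  this.\<close>

lemma tensor_hom_exists:
  assumes "assoc_algebra C" and f: "f \<in> algebra_hom A C" and g: "g \<in> algebra_hom B C"
    and comm: "\<And>a b. a \<in> carrier A \<Longrightarrow> b \<in> carrier B \<Longrightarrow> f a \<otimes>\<^bsub>C\<^esub> g b = g b \<otimes>\<^bsub>C\<^esub> f a"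
  obtains h where "h \<in> algebra_hom T C"
    and "\<And>a b. a \<in> carrier A \<Longrightarrow> b \<in> carrier B \<Longrightarrow> h (pure_tensor A B a b) = f a \<otimes>\<^bsub>C\<^esub> g b"
proof -
  interpret C: assoc_algebra C by fact
  note hom [simp] = algebra_homD[OF f] algebra_homD[OF g]
  define h where "h = tensor_lift A B C (\<lambda>a b. f a \<otimes>\<^bsub>C\<^esub> g b)"
  have h: "t \<in> carrier T \<Longrightarrow> h t \<in> carrier C"
    "s \<in> carrier T \<Longrightarrow> t \<in> carrier T \<Longrightarrow> h (s \<oplus>\<^bsub>T\<^esub> t) = h s \<oplus>\<^bsub>C\<^esub> h t"
    "h \<zero>\<^bsub>T\<^esub> = \<zero>\<^bsub>C\<^esub>"
    "a \<in> carrier A \<Longrightarrow> b \<in> carrier B \<Longrightarrow> h (pure_tensor A B a b) = f a \<otimes>\<^bsub>C\<^esub> g b" for s t a b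
    unfolding h_def
    by (rule lift[OF C.abelian_group_axioms];
      simp add: C.l_distr C.r_distr C.smult_mult_left C.smult_mult_right)+
  have swap: "f a \<otimes>\<^bsub>C\<^esub> f a' \<otimes>\<^bsub>C\<^esub> (g b \<otimes>\<^bsub>C\<^esub> g b') = f a \<otimes>\<^bsub>C\<^esub> g b \<otimes>\<^bsub>C\<^esub> (f a' \<otimes>\<^bsub>C\<^esub> g b')"
    if "a \<in> carrier A" "a' \<in> carrier A" "b \<in> carrier B" "b' \<in> carrier B" for a a' b b'
  proof -
    have "f a' \<otimes>\<^bsub>C\<^esub> (g b \<otimes>\<^bsub>C\<^esub> g b') = g b \<otimes>\<^bsub>C\<^esub> (f a' \<otimes>\<^bsub>C\<^esub> g b')"
      using that comm[of a' b] by (metis C.m_assoc hom(1) hom(6))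
    then show ?thesis using that by (simp add: C.m_assoc)
  qed
  have mult: "h (s \<otimes>\<^bsub>T\<^esub> t) = h s \<otimes>\<^bsub>C\<^esub> h t" if s: "s \<in> carrier T" and t: "t \<in> carrier T" for s t
    using s
  proof (induction s rule: tensor_induct)
    case (pure a b)
    with t show ?case
      by (induction t rule: tensor_induct)
        (simp_all add: mult_simps h swap C.r_distr)
  qed (use t in \<open>simp_all add: h mult_simps C.l_distr\<close>)
  have smult: "h (c \<odot>\<^bsub>T\<^esub> t) = c \<odot>\<^bsub>C\<^esub> h t" if "t \<in> carrier T" for c t
  proof -
    \<comment> \<open>With both elements zero in \<open>smult_mult_left\<close>, the left side is a
      product with zero and the right side is the scalar multiple of zero.\<close>
    have zero: "c \<odot>\<^bsub>C\<^esub> \<zero>\<^bsub>C\<^esub> = \<zero>\<^bsub>C\<^esub>"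
      using C.smult_mult_left[of "\<zero>\<^bsub>C\<^esub>" "\<zero>\<^bsub>C\<^esub>" c] by simp
    show ?thesis
      using that
      by (induction t rule: tensor_induct)
        (simp_all add: smult_add_T smult_closed_T smult_pure smult_zero_T h C.smult_r_distr
          C.smult_mult_left zero)
  qed
  have "h \<in> algebra_hom T C"
    by (rule algebra_homI) (simp_all add: h mult smult tensor_simps(4))
  then show thesis using h(4) by (rule that)
qed

end

section \<open>Rings given by type classes, and induction over monomials\<close>

lemma ring_of_type_algebra_simps [simp]:
  "carrier ring_of_type_algebra = (UNIV :: 'a::ring_1 set)"
  "x \<otimes>\<^bsub>ring_of_type_algebra\<^esub> y = (x * y :: 'a::ring_1)"
  "x \<oplus>\<^bsub>ring_of_type_algebra\<^esub> y = (x + y :: 'a::ring_1)"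
  "\<one>\<^bsub>ring_of_type_algebra\<^esub> = (1 :: 'a::ring_1)"
  "\<zero>\<^bsub>ring_of_type_algebra\<^esub> = (0 :: 'a::ring_1)"
  by (simp_all add: ring_of_type_algebra_def)

lemma ring_of_type_ring: "ring (ring_of_type_algebra :: 'a::ring_1 ring)"
proof (rule ringI)
  show "abelian_group (ring_of_type_algebra :: 'a ring)"
    by (rule abelian_groupI) (auto simp: algebra_simps intro: exI[of _ "- x" for x])
qed (auto intro!: monoidI simp: algebra_simps)

lemma a_inv_ring_of_type: "\<ominus>\<^bsub>ring_of_type_algebra\<^esub> x = - (x :: 'a::ring_1)"
proof -
  interpret ring "ring_of_type_algebra :: 'a ring" by (rule ring_of_type_ring)
  show ?thesis by (rule minus_equality) auto
qed

lemma poly_mapping_induct [case_names zero single add]: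
  fixes p :: "'a \<Rightarrow>\<^sub>0 'b::comm_monoid_add"
  assumes zero: "P 0" and single: "\<And>w c. P (Poly_Mapping.single w c)"
    and add: "\<And>p q. P p \<Longrightarrow> P q \<Longrightarrow> P (p + q)"
  shows "P p"
proof (induction p rule: update_induct)
  case (update p w c)
  \<comment> \<open>The key \<open>w\<close> is new, so overwriting the value 0 there is the same as
    adding a monomial.\<close>
  have "Poly_Mapping.update w c p = p + Poly_Mapping.single w c"
    using update(1) by (intro poly_mapping_eqI) (auto simp: lookup_update lookup_add lookup_single in_keys_iff)
  then show ?case using update single add by simp
qed (rule zero)

section \<open>The universal enveloping algebra\<close>

context lie_algebra
begin

abbreviation U where "U \<equiv> uea scale bracket"
abbreviation I where "I \<equiv> uea_ideal scale bracket"
abbreviation incl (\<open>\<iota>\<close>) where "incl \<equiv> uea_incl scale bracket"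

definition proj where "proj p = I +>\<^bsub>free_alg\<^esub> p"

lemma ideal_uea: "ideal I free_alg"
  unfolding uea_ideal_def by (rule ring.genideal_ideal[OF ring_of_type_ring]) simp

lemma carrier_uea: "carrier U = range proj"
  by (auto simp: uea_def Let_def FactRing_def proj_def A_RCOSETS_def RCOSETS_def a_r_coset_def)

lemma proj_closed [simp]: "proj p \<in> carrier U"
  by (simp add: carrier_uea)

lemma uea_cases:
  assumes "u \<in> carrier U" obtains p where "u = proj p"
  using assms by (auto simp: carrier_uea)

text \<open>With the operations computed on representatives, the algebra laws of \<open>U\<close>
  are inherited from the free algebra.\<close>

lemma proj_simps:
  "proj p \<oplus>\<^bsub>U\<^esub> proj q = proj (p + q)"
  "proj p \<otimes>\<^bsub>U\<^esub> proj q = proj (p * q)"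
  "\<zero>\<^bsub>U\<^esub> = proj 0"
  "\<one>\<^bsub>U\<^esub> = proj 1"
  "c \<odot>\<^bsub>U\<^esub> proj p = proj (scalar c * p)"
proof -
  interpret I: ideal I free_alg by (rule ideal_uea)
  show "proj p \<oplus>\<^bsub>U\<^esub> proj q = proj (p + q)"
    by (simp add: uea_def Let_def FactRing_def proj_def I.a_rcos_sum)
  show "proj p \<otimes>\<^bsub>U\<^esub> proj q = proj (p * q)" "c \<odot>\<^bsub>U\<^esub> proj p = proj (scalar c * p)"
    by (simp_all add: uea_def Let_def FactRing_def proj_def I.rcoset_mult_add)
  show "\<zero>\<^bsub>U\<^esub> = proj 0"
    using I.a_rcos_zero[OF ideal_uea, of 0] additive_subgroup.zero_closed[OF I.is_additive_subgroup]
    by (simp add: uea_def Let_def FactRing_def proj_def)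
  show "\<one>\<^bsub>U\<^esub> = proj 1"
    by (simp add: uea_def Let_def FactRing_def proj_def)
qed

lemma proj_eq_iff: "proj p = proj q \<longleftrightarrow> p - q \<in> I"
proof -
  interpret I: ideal I free_alg by (rule ideal_uea)
  show ?thesis
    using I.quotient_eq_iff_same_a_r_cos[OF ideal_uea, of p q] by (simp add: a_minus_def a_inv_ring_of_type proj_def)
qed

text \<open>The exponent of a scalar is the empty word and the coefficients commute. Since the
  action on \<open>U\<close> is left multiplication by the class of a scalar, this centrality is
  what allows a scalar to leave the second factor of a product.\<close>

lemma scalar_commute: "scalar c * p = p * scalar c"
  by (induction p rule: poly_mapping_induct) (simp_all add: mult_single algebra_simps mult.commute)

sublocale uea: assoc_algebra U
proof -
  have neg: "\<exists>v\<in>carrier U. v \<oplus>\<^bsub>U\<^esub> u = \<zero>\<^bsub>U\<^esub>" if "u \<in> carrier U" for u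
  proof -
    from that obtain p where "u = proj p" by (rule uea_cases)
    then show ?thesis by (intro bexI[of _ "proj (- p)"]) (simp_all add: proj_simps)
  qed
  have "abelian_group U"
    by (rule abelian_groupI; (erule neg)?) (auto elim!: uea_cases simp: proj_simps algebra_simps)
  then have "ring U"
    by (rule ringI[OF _ monoidI]) (auto elim!: uea_cases simp: proj_simps algebra_simps)
  then interpret U: ring U .
  show "assoc_algebra U"
  proof
    fix c d u v assume "u \<in> carrier U"
    then obtain p where u: "u = proj p" by (rule uea_cases)
    show "c \<odot>\<^bsub>U\<^esub> u \<in> carrier U" "(c + d) \<odot>\<^bsub>U\<^esub> u = c \<odot>\<^bsub>U\<^esub> u \<oplus>\<^bsub>U\<^esub> d \<odot>\<^bsub>U\<^esub> u"
      "(c * d) \<odot>\<^bsub>U\<^esub> u = c \<odot>\<^bsub>U\<^esub> (d \<odot>\<^bsub>U\<^esub> u)" "1 \<odot>\<^bsub>U\<^esub> u = u"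
      by (simp_all add: u proj_simps single_add algebra_simps mult.assoc[symmetric] mult_single)
    assume "v \<in> carrier U"
    then obtain q where v: "v = proj q" by (rule uea_cases)
    show "c \<odot>\<^bsub>U\<^esub> (u \<oplus>\<^bsub>U\<^esub> v) = c \<odot>\<^bsub>U\<^esub> u \<oplus>\<^bsub>U\<^esub> c \<odot>\<^bsub>U\<^esub> v"
      "(c \<odot>\<^bsub>U\<^esub> u) \<otimes>\<^bsub>U\<^esub> v = c \<odot>\<^bsub>U\<^esub> (u \<otimes>\<^bsub>U\<^esub> v)"
      by (simp_all add: u v proj_simps algebra_simps)
    have "p * (scalar c * q) = scalar c * (p * q)"
      using scalar_commute[of c p] by (metis mult.assoc)
    then show "u \<otimes>\<^bsub>U\<^esub> (c \<odot>\<^bsub>U\<^esub> v) = c \<odot>\<^bsub>U\<^esub> (u \<otimes>\<^bsub>U\<^esub> v)"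
      by (simp add: u v proj_simps)
  qed
qed

lemma incl_eq_proj: "\<iota> x = proj (letter x)"
  by (simp add: uea_incl_def proj_def)

lemma relations_subset: "uea_relations scale bracket \<subseteq> I"
  unfolding uea_ideal_def by (rule ring.genideal_self[OF ring_of_type_ring]) simp

lemma incl_closed [simp]: "\<iota> x \<in> carrier U"
  by (simp add: incl_eq_proj)

lemma incl_add: "\<iota> (x + y) = \<iota> x \<oplus>\<^bsub>U\<^esub> \<iota> y"
proof -
  have "letter (x + y) - letter x - letter y \<in> I"
    by (rule subsetD[OF relations_subset]) (auto simp: uea_relations_def)
  then show ?thesis by (simp add: incl_eq_proj proj_simps proj_eq_iff diff_diff_eq)
qed

lemma incl_scale: "\<iota> (scale c x) = c \<odot>\<^bsub>U\<^esub> \<iota> x"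
proof -
  have "letter (scale c x) - scalar c * letter x \<in> I"
    by (rule subsetD[OF relations_subset]) (auto simp: uea_relations_def)
  then show ?thesis by (simp add: incl_eq_proj proj_simps proj_eq_iff)
qed

text \<open>The commutator relation is written without subtraction so that it serves as a rewrite
  rule for sums; \<open>f_bracket\<close> below has the same form.\<close>

lemma incl_bracket: "\<iota> x \<otimes>\<^bsub>U\<^esub> \<iota> y = \<iota> y \<otimes>\<^bsub>U\<^esub> \<iota> x \<oplus>\<^bsub>U\<^esub> \<iota> (bracket x y)"
proof -
  have "letter x * letter y - letter y * letter x - letter (bracket x y) \<in> I"
    by (rule subsetD[OF relations_subset]) (auto simp: uea_relations_def)
  then show ?thesis by (simp add: incl_eq_proj proj_simps proj_eq_iff diff_diff_eq)
qed

end

section \<open>The universal property of the enveloping algebra\<close>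

locale lie_map = lie_algebra scale bracket + C: assoc_algebra C
  for scale :: "'k::field_char_0 \<Rightarrow> 'g::ab_group_add \<Rightarrow> 'g" and bracket
    and C :: "('k, 'c) module" +
  fixes f :: "'g \<Rightarrow> 'c"
  assumes f_closed [simp]: "f x \<in> carrier C"
    and f_add: "f (x + y) = f x \<oplus>\<^bsub>C\<^esub> f y"
    and f_scale: "f (scale c x) = c \<odot>\<^bsub>C\<^esub> f x"
    and f_bracket: "f x \<otimes>\<^bsub>C\<^esub> f y = f y \<otimes>\<^bsub>C\<^esub> f x \<oplus>\<^bsub>C\<^esub> f (bracket x y)"
begin

fun word_prod where
  "word_prod (Word xs) = foldr (\<lambda>x u. f x \<otimes>\<^bsub>C\<^esub> u) xs \<one>\<^bsub>C\<^esub>"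

text \<open>Evaluation of a noncommutative polynomial at \<open>f\<close>. This is the algebra map
  that descends from the free algebra to \<open>U\<close>.\<close>

definition extend where
  "extend p = finsum C (\<lambda>w. Poly_Mapping.lookup p w \<odot>\<^bsub>C\<^esub> word_prod w) (Poly_Mapping.keys p)"

lemma foldr_closed: "foldr (\<lambda>x u. f x \<otimes>\<^bsub>C\<^esub> u) xs \<one>\<^bsub>C\<^esub> \<in> carrier C"
  by (induction xs) auto

lemma word_prod_closed [simp]: "word_prod w \<in> carrier C"
  by (cases w) (simp add: foldr_closed)

lemma word_prod_add: "word_prod (v + w) = word_prod v \<otimes>\<^bsub>C\<^esub> word_prod w"
proof -
  have "foldr (\<lambda>x u. f x \<otimes>\<^bsub>C\<^esub> u) (xs @ ys) \<one>\<^bsub>C\<^esub> =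
      foldr (\<lambda>x u. f x \<otimes>\<^bsub>C\<^esub> u) xs \<one>\<^bsub>C\<^esub> \<otimes>\<^bsub>C\<^esub> foldr (\<lambda>x u. f x \<otimes>\<^bsub>C\<^esub> u) ys \<one>\<^bsub>C\<^esub>" for xs ys
    by (induction xs) (use foldr_closed in \<open>simp_all add: C.m_assoc\<close>)
  then show ?thesis by (cases v; cases w) simp
qed

lemma smult_zero: "c \<in> carrier C \<Longrightarrow> 0 \<odot>\<^bsub>C\<^esub> c = \<zero>\<^bsub>C\<^esub>"
  using C.smult_l_distr[of c 0 0] C.add.l_cancel_one[of "0 \<odot>\<^bsub>C\<^esub> c" "0 \<odot>\<^bsub>C\<^esub> c"] by simp

text \<open>Cancellation can make the support of a sum smaller than the union of the supports.
  Surplus words contribute zero, so both summands and their sum can be evaluated over one index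
  set.\<close>

lemma extend_superset:
  assumes "finite S" "Poly_Mapping.keys p \<subseteq> S"
  shows "extend p = finsum C (\<lambda>w. Poly_Mapping.lookup p w \<odot>\<^bsub>C\<^esub> word_prod w) S"
  unfolding extend_def
  by (rule C.add.finprod_mono_neutral_cong_left)
    (use assms in \<open>auto simp: smult_zero in_keys_iff\<close>)

lemma extend_closed [simp]: "extend p \<in> carrier C"
  unfolding extend_def by (rule C.finsum_closed) auto

lemma extend_add: "extend (p + q) = extend p \<oplus>\<^bsub>C\<^esub> extend q"
proof -
  let ?S = "Poly_Mapping.keys p \<union> Poly_Mapping.keys q"
  have "extend (p + q) = finsum C (\<lambda>w. Poly_Mapping.lookup (p + q) w \<odot>\<^bsub>C\<^esub> word_prod w) ?S"
    by (rule extend_superset) (use Poly_Mapping.keys_add[of p q] in auto)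
  also have "\<dots> = finsum C (\<lambda>w. Poly_Mapping.lookup p w \<odot>\<^bsub>C\<^esub> word_prod w \<oplus>\<^bsub>C\<^esub> Poly_Mapping.lookup q w \<odot>\<^bsub>C\<^esub> word_prod w) ?S"
    by (simp add: lookup_add C.smult_l_distr)
  also have "\<dots> = extend p \<oplus>\<^bsub>C\<^esub> extend q"
    using extend_superset[of ?S p] extend_superset[of ?S q] by (simp add: C.finsum_addf Pi_def)
  finally show ?thesis .
qed

lemma extend_single: "extend (Poly_Mapping.single w c) = c \<odot>\<^bsub>C\<^esub> word_prod w"
  by (subst extend_superset[of "{w}"]) (auto simp: C.finsum_singleton)

lemma extend_zero: "extend 0 = \<zero>\<^bsub>C\<^esub>"
  by (simp add: extend_def)

lemma extend_mult: "extend (p * q) = extend p \<otimes>\<^bsub>C\<^esub> extend q"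
proof (induction p rule: poly_mapping_induct)
  case (single w c)
  show ?case
  proof (induction q rule: poly_mapping_induct)
    case (single v d)
    have "(c \<odot>\<^bsub>C\<^esub> word_prod w) \<otimes>\<^bsub>C\<^esub> (d \<odot>\<^bsub>C\<^esub> word_prod v) = (c * d) \<odot>\<^bsub>C\<^esub> (word_prod w \<otimes>\<^bsub>C\<^esub> word_prod v)"
      by (simp add: C.smult_assoc[symmetric] mult.commute C.smult_mult_left C.smult_mult_right)
    then show ?case
      by (simp add: extend_single mult_single word_prod_add)
  qed (simp_all add: extend_zero extend_add ring_distribs C.r_distr)
qed (simp_all add: extend_zero extend_add ring_distribs C.l_distr)

lemma extend_scalar: "extend (scalar c) = c \<odot>\<^bsub>C\<^esub> \<one>\<^bsub>C\<^esub>"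
  by (simp add: extend_single zero_word_def)

lemma extend_letter: "extend (letter x) = f x"
  by (simp add: extend_single C.smult_one)

lemma extend_uminus: "extend (- p) = \<ominus>\<^bsub>C\<^esub> extend p"
  using extend_add[of "- p" p] by (intro C.minus_equality[symmetric]) (simp_all add: extend_zero)

lemma extend_diff: "extend (p - q) = extend p \<ominus>\<^bsub>C\<^esub> extend q"
  using extend_add[of p "- q"] by (simp add: extend_uminus a_minus_def)

lemma extend_diff_zero_iff: "extend (p - q) = \<zero>\<^bsub>C\<^esub> \<longleftrightarrow> extend p = extend q"
  by (simp add: extend_diff)

text \<open>The kernel of \<open>extend\<close> is a two-sided ideal. It contains the first two
  families of relations because \<open>f\<close> is linear and the third by
  \<open>f_bracket\<close>, so minimality of the generated ideal applies.\<close>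

lemma ideal_kernel: "I \<subseteq> {p. extend p = \<zero>\<^bsub>C\<^esub>}"
  unfolding uea_ideal_def
proof (rule ring.genideal_minimal[OF ring_of_type_ring])
  have "subgroup {p. extend p = \<zero>\<^bsub>C\<^esub>} (add_monoid free_alg)"
    by (rule group.subgroupI[OF abelian_group.a_group[OF ring.is_abelian_group[OF ring_of_type_ring]]])
      (auto simp: extend_add extend_uminus a_inv_ring_of_type a_inv_ring_of_type[unfolded a_inv_def, simplified]
        intro: exI[of _ 0] extend_zero C.minus_equality)
  then show "ideal {p. extend p = \<zero>\<^bsub>C\<^esub>} free_alg"
    by (rule idealI[OF ring_of_type_ring]) (simp_all add: extend_mult)
  show "uea_relations scale bracket \<subseteq> {p. extend p = \<zero>\<^bsub>C\<^esub>}"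
    by (auto simp: uea_relations_def diff_diff_eq extend_diff_zero_iff extend_add extend_mult
        extend_letter extend_scalar f_add f_scale C.smult_mult_left intro: f_bracket)
qed

lemma extension_exists:
  obtains h where "h \<in> algebra_hom U C" and "\<And>x. h (\<iota> x) = f x"
proof -
  \<comment> \<open>The value does not depend on the chosen representative: two of them differ by an
    element of \<open>I\<close>, where \<open>extend\<close> vanishes.\<close>
  define h where "h u = extend (SOME p. u = proj p)" for u
  have h: "h (proj p) = extend p" for p
  proof -
    have "proj p = proj (SOME q. proj p = proj q)"
      by (rule someI[of "\<lambda>q. proj p = proj q"]) simp
    then show ?thesis
      using ideal_kernel unfolding h_def proj_eq_iff by (auto simp: extend_diff_zero_iff)
  qed
  show thesis
  proof (rule that)
    show "h \<in> algebra_hom U C"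
      by (rule algebra_homI)
        (auto elim!: uea_cases simp: proj_simps h extend_add extend_mult extend_scalar
          C.smult_mult_left, simp flip: single_one add: extend_scalar C.smult_one)
    show "h (\<iota> x) = f x" for x
      by (simp add: incl_eq_proj h extend_letter)
  qed
qed

end

section \<open>Commutators and invariant tensors\<close>

lemma (in ring) commutator_closed [simp]:
  "x \<in> carrier R \<Longrightarrow> y \<in> carrier R \<Longrightarrow> commutator R x y \<in> carrier R"
  by (simp add: commutator_def)

lemma (in ring) commutator_eq_zero_iff:
  assumes "x \<in> carrier R" "y \<in> carrier R"
  shows "commutator R x y = \<zero> \<longleftrightarrow> x \<otimes> y = y \<otimes> x"
  using assms by (simp add: commutator_def)

lemma (in ring) commutator_add_left:
  assumes "x \<in> carrier R" "y \<in> carrier R" "z \<in> carrier R"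
  shows "commutator R (x \<oplus> y) z = commutator R x z \<oplus> commutator R y z"
  using assms by (simp add: commutator_def l_distr r_distr a_minus_def minus_add a_ac)

lemma (in ring) commutator_add_right:
  assumes "x \<in> carrier R" "y \<in> carrier R" "z \<in> carrier R"
  shows "commutator R x (y \<oplus> z) = commutator R x y \<oplus> commutator R x z"
  using assms by (simp add: commutator_def l_distr r_distr a_minus_def minus_add a_ac)

lemma (in ring) commutator_minus_left:
  assumes "x \<in> carrier R" "y \<in> carrier R" "z \<in> carrier R"
  shows "commutator R (x \<ominus> y) z = commutator R x z \<ominus> commutator R y z"
  using assms by (simp add: commutator_def l_distr r_distr l_minus r_minus a_minus_def minus_add a_ac)

lemma algebra_hom_additive: "h \<in> algebra_hom A B \<Longrightarrow> h \<in> hom (add_monoid A) (add_monoid B)"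
  using algebra_homD by (fastforce simp: hom_def)

lemma algebra_hom_zero:
  assumes "abelian_group A" "abelian_group B" and "h \<in> algebra_hom A B"
  shows "h \<zero>\<^bsub>A\<^esub> = \<zero>\<^bsub>B\<^esub>"
  using assms by (intro additive_zero algebra_hom_additive)

lemma algebra_hom_commutator:
  assumes "ring A" "ring B" and h: "h \<in> algebra_hom A B" and xy: "x \<in> carrier A" "y \<in> carrier A"
  shows "h (commutator A x y) = commutator B (h x) (h y)"
  using additive_minus[OF _ _ algebra_hom_additive[OF h], of "x \<otimes>\<^bsub>A\<^esub> y" "y \<otimes>\<^bsub>A\<^esub> x"] assms
  by (simp add: commutator_def ring.is_abelian_group monoid.m_closed ring.is_monoid algebra_homD[OF h])

lemma (in ring) commutes_mult:
  assumes "x \<otimes> z = z \<otimes> x" "y \<otimes> z = z \<otimes> y" "x \<in> carrier R" "y \<in> carrier R" "z \<in> carrier R"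
  shows "x \<otimes> y \<otimes> z = z \<otimes> (x \<otimes> y)"
  using assms by (metis m_assoc)

section \<open>The comultiplication on primitive elements\<close>

context lie_algebra
begin

abbreviation V where "V \<equiv> space_module scale"

lemma space_module_simps [simp]:
  "carrier V = UNIV" "x \<oplus>\<^bsub>V\<^esub> y = x + y" "\<zero>\<^bsub>V\<^esub> = 0" "c \<odot>\<^bsub>V\<^esub> x = scale c x"
  by (simp_all add: space_module_def)

lemma linear_space_space_module: "linear_space V"
proof -
  have "abelian_group V"
    by (rule abelian_groupI) (auto simp: algebra_simps intro: exI[of _ "- x" for x])
  then show ?thesis
    by (simp add: linear_space_def linear_space_axioms_def scale_right_distrib scale_left_distrib)
qed

sublocale VV: two_spaces V V
  by (simp add: two_spaces_def linear_space_space_module)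

sublocale UU: two_algebras U U
  by (simp add: two_algebras_def uea.assoc_algebra_axioms)

sublocale UUU: two_algebras "tensor U U" U
  by (simp add: two_algebras_def uea.assoc_algebra_axioms UU.T.assoc_algebra_axioms)

abbreviation V2 where "V2 \<equiv> tensor V V"
abbreviation U2 where "U2 \<equiv> tensor U U"
abbreviation U3 where "U3 \<equiv> tensor U2 U"

lemma uea2_eq: "uea2 scale bracket = U2"
  by (simp add: uea2_def)

lemma uea3_eq: "uea3 scale bracket = U3"
  by (simp add: uea3_def uea2_def)

lemma lie2_eq: "lie2 scale = V2"
  by (simp add: lie2_def)

text \<open>The value required of \<Delta> at x, named separately because it must be studied before
  a comultiplication is known to exist.\<close>

definition coprod where
  "coprod x = pure_tensor U U (\<iota> x) \<one>\<^bsub>U\<^esub> \<oplus>\<^bsub>U2\<^esub> pure_tensor U U \<one>\<^bsub>U\<^esub> (\<iota> x)"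

lemma coprod_closed [simp]: "coprod x \<in> carrier U2"
  by (simp add: coprod_def)

text \<open>In the product of x \<otimes> 1 + 1 \<otimes> x with y \<otimes> 1 + 1 \<otimes> y the
  mixed terms are x \<otimes> y and y \<otimes> x. They are the same in either order, so only the
  bracket in each factor remains.\<close>

lemma lie_map_coprod: "lie_map scale bracket U2 coprod"
proof
  fix x y c
  show "coprod x \<in> carrier U2" by simp
  show "coprod (x + y) = coprod x \<oplus>\<^bsub>U2\<^esub> coprod y"
    by (simp add: coprod_def incl_add UU.pure_add_left UU.pure_add_right UU.T.a_ac)
  show "coprod (scale c x) = c \<odot>\<^bsub>U2\<^esub> coprod x"
    by (simp add: coprod_def incl_scale UU.smult_pure UU.pure_balanced UU.smult_add_T)
  show "coprod x \<otimes>\<^bsub>U2\<^esub> coprod y = coprod y \<otimes>\<^bsub>U2\<^esub> coprod x \<oplus>\<^bsub>U2\<^esub> coprod (bracket x y)"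
    by (simp add: coprod_def UU.T.l_distr UU.T.r_distr UU.mult_pure_pure incl_bracket[of x y]
        UU.pure_add_left UU.pure_add_right UU.T.a_ac)
qed

text \<open>The universal property applied to \<open>coprod\<close> provides a witness for the
  choice in \<open>comult\<close>, so the chosen map has the prescribed values.\<close>

lemma comult_incl: "comult scale bracket (\<iota> x) = coprod x"
proof -
  interpret D: lie_map scale bracket U2 coprod by (rule lie_map_coprod)
  obtain h where "h \<in> algebra_hom U U2" "\<And>x. h (\<iota> x) = coprod x"
    using D.extension_exists by blast
  then have "\<exists>h. h \<in> ring_hom U U2 \<and> (\<forall>c. \<forall>u\<in>carrier U. h (c \<odot>\<^bsub>U\<^esub> u) = c \<odot>\<^bsub>U2\<^esub> h u) \<and>
      (\<forall>x. h (\<iota> x) = coprod x)"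
    unfolding algebra_hom_def by blast
  from someI_ex[OF this] show ?thesis
    unfolding comult_def Let_def uea2_eq pure2_def coprod_def[symmetric] by blast
qed

section \<open>Elements of the enveloping algebra and tensors placed in the tensor cube\<close>

definition pos :: "nat \<Rightarrow> ('g word \<Rightarrow>\<^sub>0 'k) set \<Rightarrow> _" where
  "pos n u = (if n = 1 then pure_tensor U2 U (pure_tensor U U u \<one>\<^bsub>U\<^esub>) \<one>\<^bsub>U\<^esub>
    else if n = 2 then pure_tensor U2 U (pure_tensor U U \<one>\<^bsub>U\<^esub> u) \<one>\<^bsub>U\<^esub>
    else pure_tensor U2 U \<one>\<^bsub>U2\<^esub> u)"

text \<open>The last branch of \<open>pos\<close> serves every \<open>n\<close> other than 1 and 2,
  so this holds without a range condition on \<open>n\<close>.\<close>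

lemma pos_hom: "pos n \<in> algebra_hom U U3"
  unfolding pos_def[abs_def]
  using algebra_hom_comp[OF UU.tensor_left_hom UUU.tensor_left_hom]
    algebra_hom_comp[OF UU.tensor_right_hom UUU.tensor_left_hom] UUU.tensor_right_hom
  by (cases "n = 1"; cases "n = 2") (simp_all del: One_nat_def)

lemmas pos_simps [simp] = algebra_homD(1,4)[OF pos_hom]

lemma pos_commute:
  fixes m n :: nat
  assumes "m \<noteq> n" "m \<in> {1, 2, 3}" "n \<in> {1, 2, 3}" "u \<in> carrier U" "v \<in> carrier U"
  shows "pos m u \<otimes>\<^bsub>U3\<^esub> pos n v = pos n v \<otimes>\<^bsub>U3\<^esub> pos m u"
  using assms by (auto simp: pos_def UUU.mult_pure_pure UU.mult_pure_pure tensor_simps(4)[of U U])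

text \<open>The slot update in \<open>place\<close> becomes a product of two elements that each
  occupy one slot. This form is preserved by algebra maps and covers both orders of \<open>i\<close>
  and \<open>j\<close> at once.\<close>

lemma place_eq:
  fixes i j :: nat
  assumes "i \<noteq> j" "i \<in> {1, 2, 3}" "j \<in> {1, 2, 3}"
  shows "place scale bracket i j = tensor_lift V V U3 (\<lambda>a b. pos i (\<iota> a) \<otimes>\<^bsub>U3\<^esub> pos j (\<iota> b))"
  unfolding place_def uea3_eq pure3_def pure2_def uea2_eq
  using assms
  by (auto simp: pos_def UUU.mult_pure_pure UU.mult_pure_pure tensor_simps(4)[of U U]
      intro!: arg_cong[where f = "tensor_lift V V U3"])

lemma place_hom:
  fixes i j :: nat
  assumes ij: "i \<noteq> j" "i \<in> {1, 2, 3}" "j \<in> {1, 2, 3}"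
  shows place_closed: "t \<in> carrier V2 \<Longrightarrow> place scale bracket i j t \<in> carrier U3"
    and place_add: "s \<in> carrier V2 \<Longrightarrow> t \<in> carrier V2 \<Longrightarrow>
      place scale bracket i j (s \<oplus>\<^bsub>V2\<^esub> t)
        = place scale bracket i j s \<oplus>\<^bsub>U3\<^esub> place scale bracket i j t"
    and place_zero: "place scale bracket i j \<zero>\<^bsub>V2\<^esub> = \<zero>\<^bsub>U3\<^esub>"
    and place_pure: "place scale bracket i j (pure_tensor V V a b)
      = pos i (\<iota> a) \<otimes>\<^bsub>U3\<^esub> pos j (\<iota> b)"
  unfolding place_eq[OF ij]
  by (rule VV.lift[OF UUU.T.abelian_group_axioms];
    simp add: incl_add incl_scale algebra_homD[OF pos_hom] UUU.T.l_distr UUU.T.r_distr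
      UUU.T.smult_mult_left UUU.T.smult_mult_right)+

lemma embed2_hom:
  shows embed2_additive: "embed2 scale bracket \<in> hom (add_monoid V2) (add_monoid U2)"
    and embed2_closed: "t \<in> carrier V2 \<Longrightarrow> embed2 scale bracket t \<in> carrier U2"
    and embed2_add: "s \<in> carrier V2 \<Longrightarrow> t \<in> carrier V2 \<Longrightarrow>
      embed2 scale bracket (s \<oplus>\<^bsub>V2\<^esub> t) = embed2 scale bracket s \<oplus>\<^bsub>U2\<^esub> embed2 scale bracket t"
    and embed2_zero: "embed2 scale bracket \<zero>\<^bsub>V2\<^esub> = \<zero>\<^bsub>U2\<^esub>"
    and embed2_pure: "embed2 scale bracket (pure_tensor V V a b) = pure_tensor U U (\<iota> a) (\<iota> b)"
  unfolding embed2_def uea2_eq pure2_def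
  by (rule VV.lift[OF UU.T.abelian_group_axioms];
    simp add: incl_add incl_scale UU.pure_add_left UU.pure_add_right UU.pure_balanced)+

text \<open>Invariance is an identity in \<open>U2\<close> involving \<Delta>(x). To use it in
  \<open>U3\<close>, placement has to be extended from tensors over the Lie algebra to an algebra
  map on all of \<open>U2\<close>; distinct slots commute, so \<open>tensor_hom_exists\<close>
  applies.\<close>

lemma two_positions_exists:
  fixes i j :: nat
  assumes "i \<noteq> j" "i \<in> {1, 2, 3}" "j \<in> {1, 2, 3}"
  obtains h where "h \<in> algebra_hom U2 U3"
    and "\<And>u v. u \<in> carrier U \<Longrightarrow> v \<in> carrier U \<Longrightarrow>
      h (pure_tensor U U u v) = pos i u \<otimes>\<^bsub>U3\<^esub> pos j v"
  using UU.tensor_hom_exists[OF UUU.T.assoc_algebra_axioms pos_hom[of i] pos_hom[of j]]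
    pos_commute[OF assms] by blast

section \<open>Tensors invariant under the diagonal adjoint action\<close>

definition invariant where
  "invariant s \<longleftrightarrow> (\<forall>x. commutator U2 (embed2 scale bracket s) (coprod x) = \<zero>\<^bsub>U2\<^esub>)"

text \<open>The algebra map of \<open>two_positions_exists\<close> sends \<open>coprod x\<close> to
  the sum on the outside and the embedded \<open>s\<close> to its placement, so it transports their
  commutation from \<open>U2\<close> to \<open>U3\<close>.\<close>

lemma two_positions_invariant:
  fixes i j :: nat
  assumes ij: "i \<noteq> j" "i \<in> {1, 2, 3}" "j \<in> {1, 2, 3}"
    and s: "s \<in> carrier V2" "invariant s"
  shows "(pos i (\<iota> x) \<oplus>\<^bsub>U3\<^esub> pos j (\<iota> x)) \<otimes>\<^bsub>U3\<^esub> place scale bracket i j s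
    = place scale bracket i j s \<otimes>\<^bsub>U3\<^esub> (pos i (\<iota> x) \<oplus>\<^bsub>U3\<^esub> pos j (\<iota> x))"
proof -
  obtain h where h: "h \<in> algebra_hom U2 U3"
    and h_pure: "\<And>u v. u \<in> carrier U \<Longrightarrow> v \<in> carrier U \<Longrightarrow>
      h (pure_tensor U U u v) = pos i u \<otimes>\<^bsub>U3\<^esub> pos j v"
    using two_positions_exists[OF ij] by blast
  have place: "place scale bracket i j s = h (embed2 scale bracket s)"
    using s(1)
    by (induction s rule: VV.tensor_induct)
      (simp_all add: place_hom[OF ij] embed2_hom h_pure algebra_homD[OF h] algebra_hom_zero[OF UU.T.abelian_group_axioms UUU.T.abelian_group_axioms h])
  have "h (coprod x) = pos i (\<iota> x) \<oplus>\<^bsub>U3\<^esub> pos j (\<iota> x)"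
    by (simp add: coprod_def algebra_homD[OF h] h_pure)
  moreover have "embed2 scale bracket s \<otimes>\<^bsub>U2\<^esub> coprod x = coprod x \<otimes>\<^bsub>U2\<^esub> embed2 scale bracket s"
    using s UU.T.commutator_eq_zero_iff[of "embed2 scale bracket s" "coprod x"]
    by (simp add: invariant_def embed2_closed)
  ultimately show ?thesis
    unfolding place using s by (metis algebra_homD(3)[OF h] coprod_closed embed2_closed)
qed

lemma pos_commute_place:
  fixes i j k :: nat
  assumes ijk: "{i, j, k} = {1, 2, 3}" "i \<noteq> j" "i \<noteq> k" "j \<noteq> k"
    and u: "u \<in> carrier U" and s: "s \<in> carrier V2"
  shows "place scale bracket j k s \<otimes>\<^bsub>U3\<^esub> pos i u = pos i u \<otimes>\<^bsub>U3\<^esub> place scale bracket j k s"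
proof -
  have mem: "i \<in> {1, 2, 3}" "j \<in> {1, 2, 3}" "k \<in> {1, 2, 3}"
    using ijk(1) by blast+
  show ?thesis
    using s
  proof (induction s rule: VV.tensor_induct)
    case (pure a b)
    show ?case
      using pos_commute[OF ijk(2)[symmetric] mem(2,1)] pos_commute[OF ijk(3)[symmetric] mem(3,1)] u
      by (simp add: place_pure[OF ijk(4) mem(2,3)] UUU.T.commutes_mult)
  qed (use mem ijk u in \<open>simp_all add: place_hom UUU.T.l_distr UUU.T.r_distr del: insert_iff\<close>)
qed

lemma place_commute_right:
  fixes i j k :: nat
  assumes ijk: "{i, j, k} = {1, 2, 3}" "i \<noteq> j" "i \<noteq> k" "j \<noteq> k"
    and s: "s \<in> carrier V2" "invariant s" and r: "r \<in> carrier V2"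
  shows "commutator U3 (place scale bracket i j r \<oplus>\<^bsub>U3\<^esub> place scale bracket i k r)
    (place scale bracket j k s) = \<zero>\<^bsub>U3\<^esub>"
proof -
  have mem: "i \<in> {1, 2, 3}" "j \<in> {1, 2, 3}" "k \<in> {1, 2, 3}"
    using ijk(1) by blast+
  note place = place_hom[OF ijk(2) mem(1,2)] place_hom[OF ijk(3) mem(1,3)]
    place_hom[OF ijk(4) mem(2,3)]
  show ?thesis
    using r
  \<comment> \<open>The arbitrary tensor \<open>r\<close> is decomposed; \<open>s\<close> stays
    whole, since the pure tensors that sum to an invariant tensor need not be invariant.\<close>
  proof (induction r rule: VV.tensor_induct)
    case zero
    then show ?case using s by (simp add: UUU.T.commutator_eq_zero_iff place)
  next
    case (pure a b)
    have "pos i (\<iota> a) \<otimes>\<^bsub>U3\<^esub> (pos j (\<iota> b) \<oplus>\<^bsub>U3\<^esub> pos k (\<iota> b)) \<otimes>\<^bsub>U3\<^esub> place scale bracket j k s =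
      place scale bracket j k s \<otimes>\<^bsub>U3\<^esub> (pos i (\<iota> a) \<otimes>\<^bsub>U3\<^esub> (pos j (\<iota> b) \<oplus>\<^bsub>U3\<^esub> pos k (\<iota> b)))"
      using two_positions_invariant[OF ijk(4) mem(2,3) s] pos_commute_place[OF ijk _ s(1)] s
      by (intro UUU.T.commutes_mult) (simp_all add: place)
    then show ?case
      using s by (simp add: UUU.T.commutator_eq_zero_iff place UUU.T.r_distr)
  next
    case (add r r')
    have "place scale bracket i j (r \<oplus>\<^bsub>V2\<^esub> r') \<oplus>\<^bsub>U3\<^esub> place scale bracket i k (r \<oplus>\<^bsub>V2\<^esub> r') =
      (place scale bracket i j r \<oplus>\<^bsub>U3\<^esub> place scale bracket i k r) \<oplus>\<^bsub>U3\<^esub>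
      (place scale bracket i j r' \<oplus>\<^bsub>U3\<^esub> place scale bracket i k r')"
      using add by (simp add: place UUU.T.a_ac)
    \<comment> \<open>The instantiation splits the commutator only at the outer sum, so that its two
      parts are the induction hypotheses.\<close>
    then show ?case
      using add s by (simp add: UUU.T.commutator_add_left[of "_ \<oplus>\<^bsub>U3\<^esub> _" "_ \<oplus>\<^bsub>U3\<^esub> _"] place)
  qed
qed

lemma place_commute_left:
  fixes i j k :: nat
  assumes ijk: "{i, j, k} = {1, 2, 3}" "i \<noteq> j" "i \<noteq> k" "j \<noteq> k"
    and s: "s \<in> carrier V2" "invariant s" and r: "r \<in> carrier V2"
  shows "commutator U3 (place scale bracket i j s)
    (place scale bracket i k r \<oplus>\<^bsub>U3\<^esub> place scale bracket j k r) = \<zero>\<^bsub>U3\<^esub>"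
proof -
  have mem: "i \<in> {1, 2, 3}" "j \<in> {1, 2, 3}" "k \<in> {1, 2, 3}"
    using ijk(1) by blast+
  \<comment> \<open>\<open>pos_commute_place\<close> expects the isolated slot first. Here that slot
    is \<open>k\<close>, since the second tensor factors of \<open>r\<close> all sit there.\<close>
  have kij: "{k, i, j} = {1, 2, 3}"
    using ijk(1) by blast
  note place = place_hom[OF ijk(2) mem(1,2)] place_hom[OF ijk(3) mem(1,3)]
    place_hom[OF ijk(4) mem(2,3)]
  show ?thesis
    using r
  proof (induction r rule: VV.tensor_induct)
    case zero
    then show ?case using s by (simp add: UUU.T.commutator_eq_zero_iff place)
  next
    case (pure a b)
    have "(pos i (\<iota> a) \<oplus>\<^bsub>U3\<^esub> pos j (\<iota> a)) \<otimes>\<^bsub>U3\<^esub> pos k (\<iota> b) \<otimes>\<^bsub>U3\<^esub> place scale bracket i j s =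
      place scale bracket i j s \<otimes>\<^bsub>U3\<^esub> ((pos i (\<iota> a) \<oplus>\<^bsub>U3\<^esub> pos j (\<iota> a)) \<otimes>\<^bsub>U3\<^esub> pos k (\<iota> b))"
      using two_positions_invariant[OF ijk(2) mem(1,2) s]
        pos_commute_place[OF kij ijk(3)[symmetric] ijk(4)[symmetric] ijk(2) _ s(1)] s
      by (intro UUU.T.commutes_mult) (simp_all add: place)
    then show ?case
      using s by (simp add: UUU.T.commutator_eq_zero_iff place UUU.T.l_distr)
  next
    case (add r r')
    have "place scale bracket i k (r \<oplus>\<^bsub>V2\<^esub> r') \<oplus>\<^bsub>U3\<^esub> place scale bracket j k (r \<oplus>\<^bsub>V2\<^esub> r') =
      (place scale bracket i k r \<oplus>\<^bsub>U3\<^esub> place scale bracket j k r) \<oplus>\<^bsub>U3\<^esub>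
      (place scale bracket i k r' \<oplus>\<^bsub>U3\<^esub> place scale bracket j k r')"
      using add by (simp add: place UUU.T.a_ac)
    then show ?case
      using add s
      by (simp add: UUU.T.commutator_add_right[of _ "_ \<oplus>\<^bsub>U3\<^esub> _" "_ \<oplus>\<^bsub>U3\<^esub> _"] place)
  qed
qed

section \<open>Permutation of the tensor factors\<close>

lemma permute_positions_exists:
  fixes i j k :: nat
  assumes ijk: "{i, j, k} = {1, 2, 3}" "i \<noteq> j" "i \<noteq> k" "j \<noteq> k"
  obtains h where "h \<in> algebra_hom U3 U3"
    and "\<And>u. u \<in> carrier U \<Longrightarrow> h (pos 1 u) = pos i u"
    and "\<And>u. u \<in> carrier U \<Longrightarrow> h (pos 2 u) = pos j u"
    and "\<And>u. u \<in> carrier U \<Longrightarrow> h (pos 3 u) = pos k u"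
proof -
  have mem: "i \<in> {1, 2, 3}" "j \<in> {1, 2, 3}" "k \<in> {1, 2, 3}"
    using ijk(1) by blast+
  obtain g where g: "g \<in> algebra_hom U2 U3"
    and g_pure: "\<And>u v. u \<in> carrier U \<Longrightarrow> v \<in> carrier U \<Longrightarrow>
      g (pure_tensor U U u v) = pos i u \<otimes>\<^bsub>U3\<^esub> pos j v"
    using two_positions_exists[OF ijk(2) mem(1,2)] by blast
  \<comment> \<open>The tensor cube is bracketed as \<open>U2\<close> times \<open>U\<close>, so the
    permutation is built in two stages. The second stage needs the whole image of \<open>g\<close>
    to commute with slot \<open>k\<close>.\<close>
  have comm: "g t \<otimes>\<^bsub>U3\<^esub> pos k w = pos k w \<otimes>\<^bsub>U3\<^esub> g t" if t: "t \<in> carrier U2" and w: "w \<in> carrier U" for t w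
    using t
  proof (induction t rule: UU.tensor_induct)
    case (pure u v)
    with w show ?case
      using pos_commute[OF ijk(3) mem(1,3)] pos_commute[OF ijk(4) mem(2,3)]
      by (simp add: g_pure UUU.T.commutes_mult)
  qed (use w in \<open>simp_all add: algebra_homD[OF g] algebra_hom_zero[OF UU.T.abelian_group_axioms UUU.T.abelian_group_axioms g] UUU.T.l_distr UUU.T.r_distr\<close>)
  obtain h where h: "h \<in> algebra_hom U3 U3"
    and h_pure: "\<And>t w. t \<in> carrier U2 \<Longrightarrow> w \<in> carrier U \<Longrightarrow>
      h (pure_tensor U2 U t w) = g t \<otimes>\<^bsub>U3\<^esub> pos k w"
    using UUU.tensor_hom_exists[OF UUU.T.assoc_algebra_axioms g pos_hom[of k] comm] by blast
  show thesis
    by (rule that[OF h])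
      (simp_all add: pos_def[of 1] pos_def[of 2] pos_def[of 3] h_pure g_pure algebra_homD[OF g]
        del: One_nat_def)
qed

lemma cybe_permute:
  fixes i j k :: nat
  assumes ijk: "{i, j, k} = {1, 2, 3}" "i \<noteq> j" "i \<noteq> k" "j \<noteq> k"
    and r: "r \<in> carrier V2"
    and cybe: "commutator U3 (place scale bracket 1 2 r) (place scale bracket 1 3 r)
      \<oplus>\<^bsub>U3\<^esub> commutator U3 (place scale bracket 1 2 r) (place scale bracket 2 3 r)
      \<oplus>\<^bsub>U3\<^esub> commutator U3 (place scale bracket 1 3 r) (place scale bracket 2 3 r) = \<zero>\<^bsub>U3\<^esub>"
  shows "commutator U3 (place scale bracket i j r) (place scale bracket i k r)
      \<oplus>\<^bsub>U3\<^esub> commutator U3 (place scale bracket i j r) (place scale bracket j k r)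
      \<oplus>\<^bsub>U3\<^esub> commutator U3 (place scale bracket i k r) (place scale bracket j k r) = \<zero>\<^bsub>U3\<^esub>"
proof -
  have mem: "i \<in> {1, 2, 3}" "j \<in> {1, 2, 3}" "k \<in> {1, 2, 3}"
    using ijk(1) by blast+
  obtain h where h: "h \<in> algebra_hom U3 U3"
    and h_pos: "\<And>u. u \<in> carrier U \<Longrightarrow> h (pos 1 u) = pos i u"
      "\<And>u. u \<in> carrier U \<Longrightarrow> h (pos 2 u) = pos j u"
      "\<And>u. u \<in> carrier U \<Longrightarrow> h (pos 3 u) = pos k u"
    using permute_positions_exists[OF ijk] by blast
  have h_zero: "h \<zero>\<^bsub>U3\<^esub> = \<zero>\<^bsub>U3\<^esub>"
    by (rule algebra_hom_zero[OF UUU.T.abelian_group_axioms UUU.T.abelian_group_axioms h])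
  \<comment> \<open>Both sides are additive in \<open>r\<close>, and on a pure tensor a placement is
    a product of two values of \<open>pos\<close>, which \<open>h\<close> moves to the new
    slots.\<close>
  have h_place: "h (place scale bracket m n r) = place scale bracket m' n' r"
    if mn: "m \<noteq> n" "m \<in> {1, 2, 3}" "n \<in> {1, 2, 3}" and mn': "m' \<noteq> n'" "m' \<in> {1, 2, 3}" "n' \<in> {1, 2, 3}"
      and pos: "\<And>u. u \<in> carrier U \<Longrightarrow> h (pos m u) = pos m' u"
        "\<And>u. u \<in> carrier U \<Longrightarrow> h (pos n u) = pos n' u" for m n m' n' :: nat
    using r
    by (induction r rule: VV.tensor_induct)
      (simp_all add: place_hom[OF mn] place_hom[OF mn'] algebra_homD[OF h] h_zero pos)
  have 12: "h (place scale bracket 1 2 r) = place scale bracket i j r"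
    by (rule h_place[OF _ _ _ ijk(2) mem(1,2) h_pos(1,2)]) simp_all
  have 13: "h (place scale bracket 1 3 r) = place scale bracket i k r"
    by (rule h_place[OF _ _ _ ijk(3) mem(1,3) h_pos(1,3)]) simp_all
  have 23: "h (place scale bracket 2 3 r) = place scale bracket j k r"
    by (rule h_place[OF _ _ _ ijk(4) mem(2,3) h_pos(2,3)]) simp_all
  have closed: "place scale bracket 1 2 r \<in> carrier U3" "place scale bracket 1 3 r \<in> carrier U3"
    "place scale bracket 2 3 r \<in> carrier U3"
    using r by (simp_all add: place_closed)
  show ?thesis
    using arg_cong[OF cybe, of h] closed
    by (simp add: algebra_homD[OF h] h_zero 12 13 23
        algebra_hom_commutator[OF UUU.T.ring_axioms UUU.T.ring_axioms h] del: One_nat_def)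
qed

section \<open>Classical r-matrices and the mixed Yang-Baxter equation\<close>

lemma r_matrix_cybe:
  fixes i j k :: nat
  assumes ijk: "{i, j, k} = {1, 2, 3}" "i \<noteq> j" "i \<noteq> k" "j \<noteq> k"
    and r: "classical_r_matrix scale bracket cobracket r"
  shows "commutator U3 (place scale bracket i j r) (place scale bracket i k r)
      \<oplus>\<^bsub>U3\<^esub> commutator U3 (place scale bracket i j r) (place scale bracket j k r)
      \<oplus>\<^bsub>U3\<^esub> commutator U3 (place scale bracket i k r) (place scale bracket j k r) = \<zero>\<^bsub>U3\<^esub>"
  using r by (intro cybe_permute[OF ijk]) (simp_all add: classical_r_matrix_def Let_def uea3_eq lie2_eq)

text \<open>Both commutators with \<Delta>(x) equal the embedded cobracket of x, so their difference
  vanishes. The sum form of the conclusion is the one in which placements and commutators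
  expand.\<close>

lemma r_matrix_difference_invariant:
  assumes r: "classical_r_matrix scale bracket cobracket r"
    and r': "classical_r_matrix scale bracket cobracket r'"
  obtains s where "s \<in> carrier V2" "invariant s" "r' = r \<oplus>\<^bsub>V2\<^esub> s"
proof
  have mem: "r \<in> carrier V2" "r' \<in> carrier V2"
    using r r' by (simp_all add: classical_r_matrix_def lie2_eq)
  then show "r' \<ominus>\<^bsub>V2\<^esub> r \<in> carrier V2" by simp
  show "r' = r \<oplus>\<^bsub>V2\<^esub> (r' \<ominus>\<^bsub>V2\<^esub> r)"
    using mem VV.T.a_lcomm[of r r' "\<ominus>\<^bsub>V2\<^esub> r"] by (simp add: a_minus_def VV.T.r_neg)
  have "commutator U2 (embed2 scale bracket r) (coprod x) = commutator U2 (embed2 scale bracket r') (coprod x)" for x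
    using r r' by (simp add: classical_r_matrix_def uea2_eq comult_incl)
  then show "invariant (r' \<ominus>\<^bsub>V2\<^esub> r)"
    using mem unfolding invariant_def
    by (simp add: additive_minus[OF VV.T.abelian_group_axioms UU.T.abelian_group_axioms embed2_additive]
        UU.T.commutator_minus_left embed2_closed)
qed

lemma mixed_cybe:
  fixes i j k :: nat
  assumes ijk: "{i, j, k} = {1, 2, 3}"
    and r: "classical_r_matrix scale bracket cobracket r"
    and r': "classical_r_matrix scale bracket cobracket r'"
    and r'': "classical_r_matrix scale bracket cobracket r''"
    and eq: "r' \<in> {r, r''}"
  shows "commutator U3 (place scale bracket i j r) (place scale bracket i k r')
      \<oplus>\<^bsub>U3\<^esub> commutator U3 (place scale bracket i j r) (place scale bracket j k r'')
      \<oplus>\<^bsub>U3\<^esub> commutator U3 (place scale bracket i k r') (place scale bracket j k r'') = \<zero>\<^bsub>U3\<^esub>"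
proof -
  have mem: "i \<in> {1, 2, 3}" "j \<in> {1, 2, 3}" "k \<in> {1, 2, 3}"
    using ijk by blast+
  \<comment> \<open>Distinctness is hidden in the set equation: a repeated index would leave fewer
    than three elements.\<close>
  have "card {i, j, k} = 3" using ijk by simp
  then have ne: "i \<noteq> j" "i \<noteq> k" "j \<noteq> k" by (auto simp: card_insert_if split: if_splits)
  note place = place_hom[OF ne(1) mem(1,2)] place_hom[OF ne(2) mem(1,3)]
    place_hom[OF ne(3) mem(2,3)]
  have r_mem: "r \<in> carrier V2" "r'' \<in> carrier V2"
    using r r'' by (simp_all add: classical_r_matrix_def lie2_eq)
  from eq consider "r' = r" | "r' = r''" by blast
  then show ?thesis
  proof cases
    case 1
    obtain s where s: "s \<in> carrier V2" "invariant s" "r'' = r \<oplus>\<^bsub>V2\<^esub> s"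
      using r_matrix_difference_invariant[OF r r''] .
    let ?X = "place scale bracket i j r" and ?Y = "place scale bracket i k r"
    let ?Z = "place scale bracket j k r" and ?S = "place scale bracket j k s"
    have closed: "?X \<in> carrier U3" "?Y \<in> carrier U3" "?Z \<in> carrier U3" "?S \<in> carrier U3"
      using r_mem s by (simp_all add: place)
    \<comment> \<open>Only the tensor in slots j, k differs from \<open>r\<close>. The two terms
      containing \<open>?S\<close> share it as right argument and combine into the commutator
      handled by \<open>place_commute_right\<close>.\<close>
    have "commutator U3 ?X ?Y \<oplus>\<^bsub>U3\<^esub> commutator U3 ?X (?Z \<oplus>\<^bsub>U3\<^esub> ?S) \<oplus>\<^bsub>U3\<^esub> commutator U3 ?Y (?Z \<oplus>\<^bsub>U3\<^esub> ?S)
      = (commutator U3 ?X ?Y \<oplus>\<^bsub>U3\<^esub> commutator U3 ?X ?Z \<oplus>\<^bsub>U3\<^esub> commutator U3 ?Y ?Z)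
        \<oplus>\<^bsub>U3\<^esub> commutator U3 (?X \<oplus>\<^bsub>U3\<^esub> ?Y) ?S"
      using closed by (simp add: UUU.T.commutator_add_right UUU.T.commutator_add_left UUU.T.a_ac)
    then show ?thesis
      using place_commute_right[OF ijk ne s(1,2) r_mem(1)] r_matrix_cybe[OF ijk ne r] r_mem s
      by (simp add: 1 place)
  next
    case 2
    obtain s where s: "s \<in> carrier V2" "invariant s" "r = r'' \<oplus>\<^bsub>V2\<^esub> s"
      using r_matrix_difference_invariant[OF r'' r] .
    let ?X = "place scale bracket i j r''" and ?Y = "place scale bracket i k r''"
    let ?Z = "place scale bracket j k r''" and ?S = "place scale bracket i j s"
    have closed: "?X \<in> carrier U3" "?Y \<in> carrier U3" "?Z \<in> carrier U3" "?S \<in> carrier U3"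
      using r_mem s by (simp_all add: place)
    \<comment> \<open>Now the tensor in slots i, j carries the difference. The two terms containing
      \<open>?S\<close> share it as left argument, which is the situation of
      \<open>place_commute_left\<close>.\<close>
    have "commutator U3 (?X \<oplus>\<^bsub>U3\<^esub> ?S) ?Y \<oplus>\<^bsub>U3\<^esub> commutator U3 (?X \<oplus>\<^bsub>U3\<^esub> ?S) ?Z \<oplus>\<^bsub>U3\<^esub> commutator U3 ?Y ?Z
      = (commutator U3 ?X ?Y \<oplus>\<^bsub>U3\<^esub> commutator U3 ?X ?Z \<oplus>\<^bsub>U3\<^esub> commutator U3 ?Y ?Z)
        \<oplus>\<^bsub>U3\<^esub> commutator U3 ?S (?Y \<oplus>\<^bsub>U3\<^esub> ?Z)"
      using closed by (simp add: UUU.T.commutator_add_right UUU.T.commutator_add_left UUU.T.a_ac)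
    then show ?thesis
      using place_commute_left[OF ijk ne s(1,2) r_mem(2)] r_matrix_cybe[OF ijk ne r''] r_mem s
      by (simp add: 2 place)
  qed
qed

end

theorem proposition2p11:
  fixes scale :: "'k::field_char_0 \<Rightarrow> 'g::ab_group_add \<Rightarrow> 'g"
    and bracket :: "'g \<Rightarrow> 'g \<Rightarrow> 'g"
    and cobracket :: "'g \<Rightarrow> ('g \<times> 'g \<Rightarrow>\<^sub>0 int) set"
    and C :: "'c set"
    and r :: "'c \<Rightarrow> ('g \<times> 'g \<Rightarrow>\<^sub>0 int) set"
    and c c' c'' :: 'c
    and i j k :: nat
  assumes "lie_bialgebra scale bracket cobracket"
    and "\<And>d. d \<in> C \<Longrightarrow> classical_r_matrix scale bracket cobracket (r d)"
    and "c \<in> C" and "c' \<in> C" and "c'' \<in> C" and "c' \<in> {c, c''}"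
    and "{i, j, k} = {1, 2, 3}"
  shows
    "commutator (uea3 scale bracket)
         (place scale bracket i j (r c)) (place scale bracket i k (r c'))
       \<oplus>\<^bsub>uea3 scale bracket\<^esub>
     commutator (uea3 scale bracket)
         (place scale bracket i j (r c)) (place scale bracket j k (r c''))
       \<oplus>\<^bsub>uea3 scale bracket\<^esub>
     commutator (uea3 scale bracket)
         (place scale bracket i k (r c')) (place scale bracket j k (r c''))
     = \<zero>\<^bsub>uea3 scale bracket\<^esub>"
proof -
  interpret lie_algebra scale bracket
    using assms(1) by (rule lie_bialgebra.axioms(1))
  show ?thesis
    unfolding uea3_eq using assms by (intro mixed_cybe) auto
qed

end
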